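(* For every integer $N \geq 1$ the set $\mathbf{Bad}_{\mathbb{P}}^{\infty}(N) \subseteq \mathbb{P}^N(\mathbb{R})$ has full Hausdorff dimension, i.e. $\dim_{\mathrm{H}}\big(\mathbf{Bad}_{\mathbb{P}}^{\infty}(N)\big) = N$.
   Context: Let $\phi:\mathbb{R}^{N+1}\setminus\{\mathbf{0}\}\to\mathbb{P}^N(\mathbb{R})$ be the quotient map sending $\mathbf{x}=(x_0,\ldots,x_N)$ to the point $\hat{\mathbf{x}}$ with homogeneous coordinates $[x_0,\ldots,x_N]$. The space $\mathbb{P}^N(\mathbb{R})$ carries the metric $$\delta_\infty(\hat{\mathbf{x}},\hat{\mathbf{y}})=\frac{|\mathbf{x}\wedge\mathbf{y}|}{|\mathbf{x}|\,|\mathbf{y}|},\qquad \hat{\mathbf{x}}=\phi(\mathbf{x}),\ \hat{\mathbf{y}}=\phi(\mathbf{y}),$$ where $|\cdot|$ is the Euclidean norm and $\wedge$ is the exterior product; equivalently, $\delta_\infty(\hat{\mathbf{x}},\hat{\mathbf{y}})$ is the sine of the smallest angle between the lines spanned by $\mathbf{x}$ and $\mathbf{y}$, so $|\mathbf{x}\wedge\mathbf{y}|^2=|\mathbf{x}|^2|\mathbf{y}|^2-(\mathbf{x}\cdot\mathbf{y})^2$. Hausdorff dimension $\dim_{\mathrm{H}}$ is taken with respect to $\delta_\infty$. $\mathbb{P}^N(\mathbb{Q})\subset\mathbb{P}^N(\mathbb{R})$ denotes the set of points having a representative in $\mathbb{Q}^{N+1}\setminus\{\mathbf{0}\}$. The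 height of $\hat{\mathbf{q}}\in\mathbb{P}^N(\mathbb{Q})$ is $H(\hat{\mathbf{q}})=\max(|q'_1|,\ldots,|q'_{N+1}|)$, where $(q'_1,\ldots,q'_{N+1})$ is a representative of $\hat{\mathbf{q}}$ consisting of integers, not all zero, with $\gcd(q'_1,\ldots,q'_{N+1})=1$. The set of badly approximable points is $$\mathbf{Bad}_{\mathbb{P}}^{\infty}(N)=\Big\{\hat{\mathbf{x}}\in\mathbb{P}^N(\mathbb{R}):\ \inf_{\hat{\mathbf{q}}\in\mathbb{P}^N(\mathbb{Q})}H(\hat{\mathbf{q}})^{\frac{N+1}{N}}\,\delta_\infty(\hat{\mathbf{x}},\hat{\mathbf{q}})>0\Big\}.$$ *)

theory Defs
  imports "HOL-Analysis.Analysis"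
begin

section \<open>The norm of the exterior product of two vectors\<close>

text \<open>
  The bivector x \<and> y is represented by the antisymmetric matrix of its coordinates.
  Every basis bivector e_i \<and> e_j with i < j then accounts for two matrix entries, hence the
  factor 2 in the Euclidean norm.
\<close>

definition wedge :: "real ^ 'n \<Rightarrow> real ^ 'n \<Rightarrow> real ^ 'n ^ 'n" where
  "wedge x y = (\<chi> i j. x $ i * y $ j - x $ j * y $ i)"

definition wedge_norm :: "real ^ 'n \<Rightarrow> real ^ 'n \<Rightarrow> real" where
  "wedge_norm x y = sqrt ((\<Sum>i\<in>UNIV. \<Sum>j\<in>UNIV. (wedge x y $ i $ j)\<^sup>2) / 2)"

lemma wedge_norm_sq:
  fixes x y :: "real ^ 'a"
  shows "(wedge_norm x y)\<^sup>2 = (norm x)\<^sup>2 * (norm y)\<^sup>2 - (x \<bullet> y)\<^sup>2"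
proof -
  have "(\<Sum>i\<in>UNIV. \<Sum>j\<in>UNIV. (wedge x y $ i $ j)\<^sup>2)
    = (\<Sum>i\<in>UNIV. \<Sum>j\<in>UNIV. (x$i * x$i) * (y$j * y$j) + (y$i * y$i) * (x$j * x$j)
        - 2 * ((x$i * y$i) * (x$j * y$j)))"
    by (intro sum.cong refl) (simp add: wedge_def power2_eq_square algebra_simps)
  also have "\<dots> = (x \<bullet> x) * (y \<bullet> y) + (y \<bullet> y) * (x \<bullet> x) - 2 * ((x \<bullet> y) * (x \<bullet> y))"
    unfolding sum.distrib sum_subtractf sum_distrib_left[symmetric]
      sum_distrib_right[symmetric] inner_vec_def inner_real_def ..
  also have "\<dots> = 2 * ((x \<bullet> x) * (y \<bullet> y) - (x \<bullet> y)\<^sup>2)"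
    by (simp add: power2_eq_square)
  finally have "(\<Sum>i\<in>UNIV. \<Sum>j\<in>UNIV. (wedge x y $ i $ j)\<^sup>2) / 2 = (x \<bullet> x) * (y \<bullet> y) - (x \<bullet> y)\<^sup>2"
    by simp
  moreover have "(\<Sum>i\<in>UNIV. \<Sum>j\<in>UNIV. (wedge x y $ i $ j)\<^sup>2) / 2 \<ge> 0"
    by (intro divide_nonneg_nonneg sum_nonneg) auto
  ultimately show ?thesis
    by (simp add: wedge_norm_def power2_norm_eq_inner)
qed

lemma wedge_norm_nonneg: "wedge_norm x y \<ge> 0"
  unfolding wedge_norm_def by (intro real_sqrt_ge_zero divide_nonneg_nonneg sum_nonneg) auto

lemma wedge_norm_commute: "wedge_norm x y = wedge_norm y x"
  by (rule power2_eq_imp_eq[OF _ wedge_norm_nonneg wedge_norm_nonneg])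
     (simp add: wedge_norm_sq inner_commute mult.commute)

lemma wedge_norm_scaleR:
  "wedge_norm (a *\<^sub>R x) (b *\<^sub>R y) = \<bar>a\<bar> * \<bar>b\<bar> * wedge_norm x y"
proof (rule power2_eq_imp_eq[OF _ wedge_norm_nonneg])
  show "(wedge_norm (a *\<^sub>R x) (b *\<^sub>R y))\<^sup>2 = (\<bar>a\<bar> * \<bar>b\<bar> * wedge_norm x y)\<^sup>2"
    by (simp add: wedge_norm_sq power_mult_distrib algebra_simps)
qed (simp add: wedge_norm_nonneg)

lemma wedge_norm_diff:
  "(norm (x - t *\<^sub>R y) * norm y)\<^sup>2 - (wedge_norm x y)\<^sup>2 = (x \<bullet> y - t * (y \<bullet> y))\<^sup>2"
proof -
  have "(norm (x - t *\<^sub>R y))\<^sup>2 = x \<bullet> x - 2 * t * (x \<bullet> y) + t\<^sup>2 * (y \<bullet> y)"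
    unfolding power2_norm_eq_inner
    by (simp add: inner_diff_left inner_diff_right inner_commute[of y x] power2_eq_square
        algebra_simps)
  then have "(norm (x - t *\<^sub>R y) * norm y)\<^sup>2
      = (x \<bullet> x - 2 * t * (x \<bullet> y) + t\<^sup>2 * (y \<bullet> y)) * (y \<bullet> y)"
    by (simp only: power_mult_distrib power2_norm_eq_inner[of y])
  then show ?thesis
    unfolding wedge_norm_sq power2_norm_eq_inner by (simp add: power2_eq_square algebra_simps)
qed

lemma wedge_norm_le: "wedge_norm x y \<le> norm (x - t *\<^sub>R y) * norm y"
proof (rule power2_le_imp_le)
  show "(wedge_norm x y)\<^sup>2 \<le> (norm (x - t *\<^sub>R y) * norm y)\<^sup>2"
    using wedge_norm_diff[of x t y] zero_le_power2[of "x \<bullet> y - t * (y \<bullet> y)"] by linarith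
qed simp

lemma wedge_norm_proj:
  assumes "y \<noteq> 0"
  shows "wedge_norm x y = norm (x - ((x \<bullet> y) / (y \<bullet> y)) *\<^sub>R y) * norm y"
proof (rule power2_eq_imp_eq[OF _ wedge_norm_nonneg])
  define t where "t = (x \<bullet> y) / (y \<bullet> y)"
  have "x \<bullet> y - t * (y \<bullet> y) = 0"
    using assms by (simp add: t_def)
  then have "(norm (x - t *\<^sub>R y) * norm y)\<^sup>2 - (wedge_norm x y)\<^sup>2 = 0"
    unfolding wedge_norm_diff by simp
  then show "(wedge_norm x y)\<^sup>2 = (norm (x - ((x \<bullet> y) / (y \<bullet> y)) *\<^sub>R y) * norm y)\<^sup>2"
    unfolding t_def by linarith
qed simp

section \<open>Real projective space\<close>

definition proj_rel :: "real ^ 'n \<Rightarrow> real ^ 'n \<Rightarrow> bool" where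
  "proj_rel x y \<longleftrightarrow> x \<noteq> 0 \<and> y \<noteq> 0 \<and> (\<exists>c. x = c *\<^sub>R y)"

lemma proj_relE:
  assumes "proj_rel x y"
  obtains c where "c \<noteq> 0" "x = c *\<^sub>R y" "x \<noteq> 0" "y \<noteq> 0"
  using assms by (auto simp: proj_rel_def)

text \<open>
  The type \<open>'n proj\<close> is the space of lines in \<open>real ^ 'n\<close>, a projective space of dimension
  \<open>CARD('n) - 1\<close>; \<open>proj_of\<close> is the quotient map, to be applied to nonzero vectors only.
\<close>

quotient_type (overloaded) 'n proj = "real ^ ('n::finite)" / partial: proj_rel
  morphisms rep_proj proj_of
proof (rule part_equivpI)
  show "\<exists>x :: real ^ 'n. proj_rel x x"
    by (rule exI[of _ 1]) (auto simp: proj_rel_def intro: exI[of _ 1])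
  show "symp (proj_rel :: real ^ 'n \<Rightarrow> _)"
  proof (rule sympI)
    fix x y :: "real ^ 'n"
    assume "proj_rel x y"
    then obtain c where "c \<noteq> 0" "x = c *\<^sub>R y" "x \<noteq> 0" "y \<noteq> 0"
      by (rule proj_relE)
    then show "proj_rel y x"
      by (auto simp: proj_rel_def intro!: exI[of _ "1/c"])
  qed
  show "transp (proj_rel :: real ^ 'n \<Rightarrow> _)"
    by (rule transpI) (auto simp: proj_rel_def)
qed

lemma proj_of_eq_iff:
  assumes "x \<noteq> 0" "y \<noteq> 0"
  shows "proj_of x = proj_of y \<longleftrightarrow> (\<exists>c. x = c *\<^sub>R y)"
proof -
  have "proj_rel x x" "proj_rel y y"
    using assms by (auto simp: proj_rel_def intro: exI[of _ 1])
  then have "proj_of x = proj_of y \<longleftrightarrow> proj_rel x y"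
    by (meson Quotient_proj Quotient_rel)
  then show ?thesis
    using assms by (simp add: proj_rel_def)
qed

lemma proj_cases:
  obtains x where "x \<noteq> 0" "p = proj_of x"
  by (metis Quotient_proj Quotient_abs_rep Quotient_rep_reflp proj_rel_def)

text \<open>
  The topology and the uniformity of projective space are those induced by the metric
  given by the sine of the angle between two lines.
\<close>

instantiation proj :: (finite) metric_space
begin

lift_definition dist_proj :: "'a proj \<Rightarrow> 'a proj \<Rightarrow> real"
  is "\<lambda>x y. wedge_norm x y / (norm x * norm y)"
  by (auto elim!: proj_relE simp: wedge_norm_scaleR)

definition uniformity_proj :: "('a proj \<times> 'a proj) filter" where
  "uniformity_proj = (INF e\<in>{0<..}. principal {(x, y). dist x y < e})"

definition open_proj :: "'a proj set \<Rightarrow> bool" where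
  "open_proj U \<longleftrightarrow> (\<forall>x\<in>U. eventually (\<lambda>(x', y). x' = x \<longrightarrow> y \<in> U) uniformity)"

lemma dist_proj_of:
  fixes x y :: "real ^ 'a"
  assumes "x \<noteq> 0" "y \<noteq> 0"
  shows "dist (proj_of x) (proj_of y) = wedge_norm x y / (norm x * norm y)"
  by (rule dist_proj.abs_eq) (use assms in \<open>auto simp: proj_rel_def intro: exI[of _ 1]\<close>)

instance
proof
  fix p q :: "'a proj"
  obtain x where x: "x \<noteq> 0" "p = proj_of x" by (rule proj_cases)
  obtain y where y: "y \<noteq> 0" "q = proj_of y" by (rule proj_cases)
  have "dist p q = 0 \<longleftrightarrow> wedge_norm x y = 0"
    using x y by (simp add: dist_proj_of)
  also have "\<dots> \<longleftrightarrow> (\<exists>c. x = c *\<^sub>R y)"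
  proof
    assume "wedge_norm x y = 0"
    then have "x = ((x \<bullet> y) / (y \<bullet> y)) *\<^sub>R y"
      using wedge_norm_proj[OF y(1), of x] y(1) by simp
    then show "\<exists>c. x = c *\<^sub>R y" by blast
  next
    assume "\<exists>c. x = c *\<^sub>R y"
    then obtain c where "x = c *\<^sub>R y" by blast
    then show "wedge_norm x y = 0"
      using wedge_norm_le[of x y c] wedge_norm_nonneg[of x y] by simp
  qed
  also have "\<dots> \<longleftrightarrow> p = q"
    using x y by (simp add: proj_of_eq_iff)
  finally show "dist p q = 0 \<longleftrightarrow> p = q" .
next
  fix p q r :: "'a proj"
  obtain x where x: "x \<noteq> 0" "p = proj_of x" by (rule proj_cases)
  obtain y where y: "y \<noteq> 0" "q = proj_of y" by (rule proj_cases)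
  obtain z where z: "z \<noteq> 0" "r = proj_of z" by (rule proj_cases)
  define a where "a = (x \<bullet> z) / (z \<bullet> z)"
  define b where "b = (z \<bullet> y) / (y \<bullet> y)"
  have "\<bar>a\<bar> * norm z = \<bar>x \<bullet> z\<bar> / norm z"
    using z(1) by (simp add: a_def dot_square_norm power2_eq_square)
  also have "\<dots> \<le> norm x"
    using z(1) Cauchy_Schwarz_ineq2[of x z] by (simp add: divide_le_eq)
  finally have a: "\<bar>a\<bar> * norm z \<le> norm x" .
  have 1: "wedge_norm x z / norm z = norm (x - a *\<^sub>R z)"
    using wedge_norm_proj[OF z(1), of x] z(1) by (simp add: a_def)
  have 2: "wedge_norm z y / norm y = norm (z - b *\<^sub>R y)"
    using wedge_norm_proj[OF y(1), of z] y(1) by (simp add: b_def)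
  have "wedge_norm x y / norm y \<le> norm (x - (a * b) *\<^sub>R y)"
    using wedge_norm_le[of x y "a * b"] y(1) by (simp add: divide_le_eq)
  also have "\<dots> = norm ((x - a *\<^sub>R z) + a *\<^sub>R (z - b *\<^sub>R y))"
    by (simp add: algebra_simps)
  also have "\<dots> \<le> norm (x - a *\<^sub>R z) + \<bar>a\<bar> * norm (z - b *\<^sub>R y)"
    using norm_triangle_ineq[of "x - a *\<^sub>R z" "a *\<^sub>R (z - b *\<^sub>R y)"] by simp
  also have "\<bar>a\<bar> * norm (z - b *\<^sub>R y) = (\<bar>a\<bar> * norm z) * (norm (z - b *\<^sub>R y) / norm z)"
    using z(1) by simp
  also have "\<dots> \<le> norm x * (norm (z - b *\<^sub>R y) / norm z)"
    by (rule mult_right_mono[OF a]) simp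
  finally have "wedge_norm x y / norm y
      \<le> wedge_norm x z / norm z + norm x * (wedge_norm z y / norm y / norm z)"
    unfolding 1 2 by simp
  then have "(wedge_norm x y / norm y) / norm x
      \<le> (wedge_norm x z / norm z + norm x * (wedge_norm z y / norm y / norm z)) / norm x"
    by (rule divide_right_mono) simp
  then have "wedge_norm x y / (norm x * norm y)
      \<le> wedge_norm x z / (norm x * norm z) + wedge_norm y z / (norm y * norm z)"
    using x(1) by (simp add: add_divide_distrib wedge_norm_commute[of z y] mult.commute)
  then show "dist p q \<le> dist p r + dist q r"
    using x y z by (simp add: dist_proj_of)
qed (rule uniformity_proj_def open_proj_def)+

end

section \<open>Rational points and their height\<close>

definition rat_points :: "('n::finite) proj set" where
  "rat_points = {proj_of q | q. q \<noteq> 0 \<and> (\<forall>i. q $ i \<in> \<rat>)}"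

definition real_vec :: "int ^ 'n \<Rightarrow> real ^ 'n" where
  "real_vec q = (\<chi> i. real_of_int (q $ i))"

text \<open>\<open>Gcd A = 1\<close> implies that \<open>A\<close> contains a nonzero integer.\<close>

definition primitive_rep :: "int ^ 'n \<Rightarrow> ('n::finite) proj \<Rightarrow> bool" where
  "primitive_rep q p \<longleftrightarrow> Gcd (range (\<lambda>i. q $ i)) = 1 \<and> p = proj_of (real_vec q)"

definition height :: "('n::finite) proj \<Rightarrow> real" where
  "height p = (THE h. \<exists>q. primitive_rep q p \<and> h = real_of_int (Max (range (\<lambda>i. \<bar>q $ i\<bar>))))"

lemma primitive_nonzero:
  fixes q :: "int ^ 'n"
  assumes "Gcd (range (\<lambda>i. q $ i)) = 1"
  shows "real_vec q \<noteq> 0"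
proof
  assume "real_vec q = 0"
  then have "range (\<lambda>i. q $ i) = {0}"
    by (auto simp: real_vec_def vec_eq_iff)
  with assms show False by simp
qed

lemma primitive_rep_unique:
  fixes q r :: "int ^ 'n"
  assumes "primitive_rep q p" "primitive_rep r p"
  shows "\<bar>q $ i\<bar> = \<bar>r $ i\<bar>"
proof -
  have *: "q' $ i dvd r' $ i"
    if "primitive_rep q' p" "primitive_rep r' p" for q' r' :: "int ^ 'n" and i
  proof -
    have g: "Gcd (range (\<lambda>i. q' $ i)) = 1" "Gcd (range (\<lambda>i. r' $ i)) = 1"
      and e: "proj_of (real_vec q') = proj_of (real_vec r')"
      using that by (auto simp: primitive_rep_def)
    obtain c where c: "real_vec q' = c *\<^sub>R real_vec r'"
      using e proj_of_eq_iff[OF primitive_nonzero primitive_nonzero, OF g] by blast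
    have cross: "q' $ i * r' $ j = q' $ j * r' $ i" for i j
    proof -
      have "real_of_int (q' $ k) = c * real_of_int (r' $ k)" for k
        using c by (simp add: real_vec_def vec_eq_iff)
      then have "real_of_int (q' $ i * r' $ j) = real_of_int (q' $ j * r' $ i)"
        by simp
      then show ?thesis by linarith
    qed
    have "q' $ i dvd Gcd ((*) (r' $ i) ` range (\<lambda>j. q' $ j))"
      by (rule Gcd_greatest) (auto, metis cross dvd_triv_left mult.commute)
    also have "Gcd ((*) (r' $ i) ` range (\<lambda>j. q' $ j)) = normalize (r' $ i)"
      using Gcd_mult[of "r' $ i" "range (\<lambda>j. q' $ j)"] g by simp
    finally show ?thesis by simp
  qed
  show ?thesis
    using *[OF assms] *[OF assms(2,1)] by (intro zdvd_antisym_abs) auto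
qed

lemma primitive_rep_exists:
  assumes "p \<in> rat_points"
  obtains q where "primitive_rep q p"
proof -
  obtain q where q: "q \<noteq> 0" "\<forall>i. q $ i \<in> \<rat>" "p = proj_of q"
    using assms by (auto simp: rat_points_def)
  have "\<exists>a b. b \<noteq> 0 \<and> q $ i = real_of_int a / real_of_int b" for i
    using q(2) by (metis Rats_cases' less_irrefl)
  then obtain a b where ab: "\<And>i. b i \<noteq> 0" "\<And>i. q $ i = real_of_int (a i) / real_of_int (b i)"
    by metis
  define D where "D = (\<Prod>i\<in>UNIV. b i)"
  have D: "D \<noteq> 0"
    using ab(1) by (simp add: D_def)
  define c where "c i = a i * (D div b i)" for i
  have c: "real_of_int (c i) = real_of_int D * q $ i" for i
  proof -
    have "b i dvd D"
      unfolding D_def by (rule dvd_prodI) auto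
    then have "real_of_int (D div b i) = real_of_int D / real_of_int (b i)"
      by (rule real_of_int_div)
    then show ?thesis
      by (simp add: c_def ab(2))
  qed
  define g where "g = Gcd (range c)"
  have "\<exists>i. c i \<noteq> 0"
  proof (rule ccontr)
    assume "\<not> ?thesis"
    then have "q $ i = 0" for i
      using c[of i] D by simp
    with q(1) show False
      by (simp add: vec_eq_iff)
  qed
  then have g: "g \<noteq> 0"
    by (auto simp: g_def)
  have gdvd: "g dvd c i" for i
    by (simp add: g_def)
  define r where "r = (\<chi> i. c i div g)"
  have r: "c i = g * r $ i" for i
    using gdvd[of i] by (simp add: r_def)
  have "g = Gcd ((*) g ` range (\<lambda>i. r $ i))"
    by (simp add: image_image flip: r) (simp add: g_def)
  also have "\<dots> = normalize (g * Gcd (range (\<lambda>i. r $ i)))"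
    by (rule Gcd_mult)
  finally have "g = \<bar>g\<bar> * Gcd (range (\<lambda>i. r $ i))"
    by (simp add: abs_mult)
  moreover have "\<bar>g\<bar> = g"
    by (simp add: g_def)
  ultimately have "\<bar>g\<bar> * Gcd (range (\<lambda>i. r $ i)) = \<bar>g\<bar> * 1"
    by simp
  then have 1: "Gcd (range (\<lambda>i. r $ i)) = 1"
    using g by simp
  have "real_vec r = (real_of_int D / real_of_int g) *\<^sub>R q"
  proof -
    have "real_of_int (r $ i) = real_of_int D / real_of_int g * q $ i" for i
      using c[of i] r[of i] g by (simp add: field_simps)
    then show ?thesis
      by (simp add: vec_eq_iff real_vec_def)
  qed
  then have "proj_of (real_vec r) = p"
    using proj_of_eq_iff[OF primitive_nonzero[OF 1] q(1)] q(3) by blast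
  then show ?thesis
    using that[of r] 1 by (simp add: primitive_rep_def)
qed

lemma height_eq:
  assumes "primitive_rep q p"
  shows "height p = real_of_int (Max (range (\<lambda>i. \<bar>q $ i\<bar>)))"
  unfolding height_def
proof (rule the_equality)
  fix h
  assume "\<exists>r. primitive_rep r p \<and> h = real_of_int (Max (range (\<lambda>i. \<bar>r $ i\<bar>)))"
  then show "h = real_of_int (Max (range (\<lambda>i. \<bar>q $ i\<bar>)))"
    using primitive_rep_unique[OF assms] by auto
qed (use assms in blast)

section \<open>Badly approximable points\<close>

text \<open>With \<open>N = CARD('n) - 1\<close> the exponent of the height is (N + 1) / N.\<close>

definition bad_proj :: "('n::finite) proj set" where
  "bad_proj = {x. (INF q\<in>rat_points.
      height q powr (real CARD('n) / (real CARD('n) - 1)) * dist x q) > 0}"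

section \<open>Hausdorff dimension\<close>

text \<open>
  The boundedness condition on the covering sets only excludes sets of infinite diameter, for
  which \<open>diameter\<close> is not meaningful. The second case of the gauge gives the convention
  0 powr 0 = 1 for nonempty sets, so that the zero-dimensional measure counts points.
\<close>

definition hausdorff_gauge :: "real \<Rightarrow> 'a::metric_space set \<Rightarrow> ennreal" where
  "hausdorff_gauge s U =
    (if U = {} then 0 else if s = 0 then 1 else ennreal (diameter U powr s))"

definition hausdorff_premeasure :: "real \<Rightarrow> real \<Rightarrow> 'a::metric_space set \<Rightarrow> ennreal" where
  "hausdorff_premeasure s \<delta> A =
    (INF U \<in> {U :: nat \<Rightarrow> 'a set. A \<subseteq> (\<Union>i. U i) \<and> (\<forall>i. bounded (U i) \<and> diameter (U i) \<le> \<delta>)}.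
      \<Sum>i. hausdorff_gauge s (U i))"

definition hausdorff_measure :: "real \<Rightarrow> 'a::metric_space set \<Rightarrow> ennreal" where
  "hausdorff_measure s A = (SUP \<delta>\<in>{0<..}. hausdorff_premeasure s \<delta> A)"

definition hausdorff_dim :: "'a::metric_space set \<Rightarrow> ereal" where
  "hausdorff_dim A = Inf (ereal ` {s. s \<ge> 0 \<and> hausdorff_measure s A = 0})"

end

theory Submission
  imports Defs
begin

text \<open>
  In an affine chart, badly approximable points are found in a Cantor set. By the simplex lemma, the
  rational points of height comparable to \<open>M ^ (k N / (N + 1))\<close> that are close to a cube of side \<open>1 / M ^ k\<close>
  lie on one hyperplane. A neighbourhood of that hyperplane of width about \<open>1 / M ^ (k + 1)\<close> meets only
  \<open>O(M ^ (N - 1))\<close> of the \<open>M ^ N\<close> subcubes of side \<open>1 / M ^ (k + 1)\<close>; the others are kept. Hence every cube keeps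
  at least \<open>M ^ s\<close> subcubes, for any \<open>s < N\<close> and \<open>M\<close> large, and the limit set has dimension at least \<open>s\<close>.
\<close>

text \<open>Removing rational points one by one would fail, since many of them may crowd near one
  cube. The exponent (N + 1) / N is what saves the construction. For heights near Q =
  \<open>M ^ (k * N / (N + 1))\<close> the forbidden distance, a constant times the power -(N + 1) /
  N of Q, has order \<open>1 / M ^ k\<close>, the side of the cube. At the same scale N + 1 integer
  vectors of height at most Q pointing into the cube have determinant of order at most Q ^ (N + 1) /
  M ^ (k * N) = 1. A small constant pushes it below 1, the least nonzero value for integer vectors,
  so all of them lie on one hyperplane. The share of subcubes lost to its neighbourhood is at most a
  constant over \<open>M\<close>, which costs nothing in the exponent as \<open>M\<close> grows. The
  upper bound on the dimension has no arithmetic content: it holds for every subset of projective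
  space.\<close>

section \<open>Trees and lower bounds for Hausdorff measures\<close>

text \<open>
  The probability that a random descent from \<open>v\<close>, choosing each child uniformly, satisfies \<open>P\<close>
  after \<open>d\<close> steps. It takes the place of the mass distribution on the limit set: no measure on
  the limit set is needed, since a branch that avoids all sets of a cheap cover can be chosen step by step.
\<close>

fun hit_mass :: "('v \<Rightarrow> 'v set) \<Rightarrow> ('v \<Rightarrow> bool) \<Rightarrow> nat \<Rightarrow> 'v \<Rightarrow> real" where
  "hit_mass ch P 0 v = (if P v then 1 else 0)"
| "hit_mass ch P (Suc d) v = (\<Sum>w\<in>ch v. hit_mass ch P d w) / card (ch v)"

fun descendants :: "('v \<Rightarrow> 'v set) \<Rightarrow> nat \<Rightarrow> 'v \<Rightarrow> 'v set" where
  "descendants ch 0 v = {v}"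
| "descendants ch (Suc d) v = (\<Union>w\<in>ch v. descendants ch d w)"

lemma hit_mass_nonneg: "hit_mass ch P d v \<ge> 0"
  by (induction d arbitrary: v) (auto intro!: divide_nonneg_nonneg sum_nonneg)

lemma descendants_parent:
  assumes "\<And>v w. v \<in> V \<Longrightarrow> w \<in> ch v \<Longrightarrow> w \<in> V \<and> par w = v"
    and "w \<in> descendants ch d v" "v \<in> V"
  shows "(par ^^ d) w = v"
  using assms(2,3)
proof (induction d arbitrary: v)
  case (Suc d)
  then obtain u where u: "u \<in> ch v" "w \<in> descendants ch d u" by auto
  then have "u \<in> V" "par u = v" using assms(1) Suc.prems(2) by auto
  then show ?case using Suc.IH[of u] u by simp
qed simp

lemma finite_descendants:
  assumes "\<And>v. v \<in> V \<Longrightarrow> finite (ch v) \<and> ch v \<subseteq> V" and "v \<in> V"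
  shows "finite (descendants ch d v)"
  using assms(2)
proof (induction d arbitrary: v)
  case (Suc d)
  then show ?case using assms(1)[of v] by auto
qed simp

text \<open>Every step of the descent divides by at least \<open>m\<close>, so a single descendant
  of depth \<open>d\<close> is reached with probability at most \<open>1 / m ^ d\<close>. The map
  \<open>par\<close> guarantees that no descendant is reached through two children.\<close>

lemma hit_mass_le:
  fixes ch :: "'v \<Rightarrow> 'v set"
  assumes par: "\<And>v w. v \<in> V \<Longrightarrow> w \<in> ch v \<Longrightarrow> par w = v"
    and ch: "\<And>v. v \<in> V \<Longrightarrow> finite (ch v) \<and> ch v \<subseteq> V \<and> m \<le> real (card (ch v))"
    and m: "m > 0" and "v \<in> V"
  shows "hit_mass ch P d v \<le> card {w \<in> descendants ch d v. P w} / m ^ d"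
  using \<open>v \<in> V\<close>
proof (induction d arbitrary: v)
  case 0
  have "{w. w = v \<and> P w} = (if P v then {v} else {})" by auto
  then show ?case by simp
next
  case (Suc d)
  define D where "D w = {u \<in> descendants ch d w. P u}" for w
  have fin: "finite (ch v)" and sub: "ch v \<subseteq> V" and mc: "m \<le> card (ch v)"
    using ch[OF Suc.prems] by auto
  have "{w \<in> descendants ch (Suc d) v. P w} = (\<Union>w\<in>ch v. D w)"
    by (auto simp: D_def)
  also have "card \<dots> = (\<Sum>w\<in>ch v. card (D w))"
  proof (rule card_UN_disjoint)
    have "finite (descendants ch d w)" if "w \<in> ch v" for w
      by (rule finite_descendants[of V]) (use ch sub that in blast)+
    then show "\<forall>w\<in>ch v. finite (D w)" by (simp add: D_def)
    show "\<forall>i\<in>ch v. \<forall>j\<in>ch v. i \<noteq> j \<longrightarrow> D i \<inter> D j = {}"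
    proof (intro ballI impI)
      fix i j assume "i \<in> ch v" "j \<in> ch v" "i \<noteq> j"
      moreover have "(par ^^ d) u = w" if "u \<in> D w" "w \<in> ch v" for u w
      proof (rule descendants_parent[of V])
        show "w' \<in> V \<and> par w' = v'" if "v' \<in> V" "w' \<in> ch v'" for v' w'
          using ch[OF that(1)] par[OF that] that(2) by auto
        show "u \<in> descendants ch d w" "w \<in> V"
          using that sub by (auto simp: D_def)
      qed
      ultimately show "D i \<inter> D j = {}" by blast
    qed
  qed (rule fin)
  finally have card: "card {w \<in> descendants ch (Suc d) v. P w} = (\<Sum>w\<in>ch v. card (D w))" .
  have "hit_mass ch P (Suc d) v = (\<Sum>w\<in>ch v. hit_mass ch P d w) / card (ch v)"
    by simp
  also have "\<dots> \<le> (\<Sum>w\<in>ch v. hit_mass ch P d w) / m"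
    using mc m by (intro divide_left_mono sum_nonneg hit_mass_nonneg) auto
  also have "\<dots> \<le> (\<Sum>w\<in>ch v. card (D w) / m ^ d) / m"
    using m sub Suc.IH by (intro divide_right_mono sum_mono) (auto simp: D_def)
  also have "\<dots> = (\<Sum>w\<in>ch v. card (D w)) / m ^ Suc d"
    by (simp add: sum_divide_distrib mult.commute)
  finally show ?case unfolding card by simp
qed

text \<open>
  The expected number of sets still to be hit is the average of its values at the children, so
  some child keeps it below 1.
\<close>

lemma avoiding_branch:
  fixes k :: "nat \<Rightarrow> nat"
  assumes ch: "\<And>v. v \<in> V \<Longrightarrow> finite (ch v) \<and> ch v \<subseteq> V \<and> ch v \<noteq> {}"
    and r: "r \<in> V" and small: "(\<Sum>i. ennreal (hit_mass ch (P i) (k i) r)) < 1"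
  obtains b where "b 0 = r" "\<And>n. b (Suc n) \<in> ch (b n)" "\<And>i. \<not> P i (b (k i))"
proof -
  \<comment> \<open>Beyond level \<open>k i\<close> the i-th set is dropped; a hit at level
    \<open>k i\<close> itself contributes a full 1, which a total below 1 rules out.\<close>
  define f where "f n v i = (if n \<le> k i then ennreal (hit_mass ch (P i) (k i - n) v) else 0)"
    for n v i
  define W where "W n v = (\<Sum>i. f n v i)" for n v
  have step: "\<exists>w. w \<in> ch v \<and> W (Suc n) w < 1" if v: "v \<in> V" and less: "W n v < 1" for n v
  proof (rule ccontr)
    let ?c = "ennreal (card (ch v))"
    have fin: "finite (ch v)" and pos: "card (ch v) > 0"
      using ch[OF v] by (auto simp: card_gt_0_iff)
    assume "\<not> ?thesis"
    then have "1 \<le> W (Suc n) w" if "w \<in> ch v" for w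
      using that by (meson not_le)
    then have "(\<Sum>w\<in>ch v. 1) \<le> (\<Sum>w\<in>ch v. W (Suc n) w)"
      by (rule sum_mono)
    also have "\<dots> = (\<Sum>i. \<Sum>w\<in>ch v. f (Suc n) w i)"
      unfolding W_def by (subst suminf_sum) auto
    \<comment> \<open>Averaging gives equality while the i-th set is pending; from level
      \<open>k i\<close> on, the left side is 0.\<close>
    also have "\<dots> \<le> (\<Sum>i. ?c * f n v i)"
    proof (rule suminf_le)
      show "(\<Sum>w\<in>ch v. f (Suc n) w i) \<le> ?c * f n v i" for i
      proof (cases "Suc n \<le> k i")
        case True
        then obtain d where d: "k i - n = Suc d" "k i - Suc n = d"
          by (metis Suc_diff_le diff_Suc_Suc)
        have "(\<Sum>w\<in>ch v. f (Suc n) w i) = ennreal (\<Sum>w\<in>ch v. hit_mass ch (P i) d w)"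
          using True d by (simp add: f_def hit_mass_nonneg)
        also have "\<dots> = ennreal (card (ch v) * hit_mass ch (P i) (Suc d) v)"
          using pos by simp
        also have "\<dots> = ?c * f n v i"
          using True d by (simp add: f_def ennreal_mult del: hit_mass.simps add: hit_mass_nonneg)
        finally show ?thesis by simp
      qed (simp add: f_def)
    qed auto
    also have "\<dots> = ?c * W n v"
      unfolding W_def by simp
    also have "\<dots> < ?c * 1"
      using less pos by (intro ennreal_mult_strict_left_mono) auto
    finally show False
      by (simp add: ennreal_of_nat_eq_real_of_nat)
  qed
  have "\<exists>b. \<forall>n. (b n \<in> V \<and> W n (b n) < 1 \<and> (n = 0 \<longrightarrow> b n = r)) \<and> b (Suc n) \<in> ch (b n)"
  proof (rule dependent_nat_choice)
    show "\<exists>v. v \<in> V \<and> W 0 v < 1 \<and> (0 = (0::nat) \<longrightarrow> v = r)"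
      using r small by (auto simp: W_def f_def)
    fix v n assume v: "v \<in> V \<and> W n v < 1 \<and> (n = 0 \<longrightarrow> v = r)"
    then show "\<exists>w. (w \<in> V \<and> W (Suc n) w < 1 \<and> (Suc n = 0 \<longrightarrow> w = r)) \<and> w \<in> ch v"
      using step[of v n] ch[of v] by blast
  qed
  then obtain b where b: "\<And>n. W n (b n) < 1" "b 0 = r" "\<And>n. b (Suc n) \<in> ch (b n)"
    by auto
  have "\<not> P i (b (k i))" for i
  proof
    assume "P i (b (k i))"
    then have "1 = f (k i) (b (k i)) i" by (simp add: f_def)
    also have "\<dots> = (\<Sum>j\<in>{i}. f (k i) (b (k i)) j)" by simp
    also have "\<dots> \<le> W (k i) (b (k i))"
      unfolding W_def by (rule sum_le_suminf) auto
    finally show False using b(1)[of "k i"] by simp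
  qed
  with b that show ?thesis by blast
qed

text \<open>The level at which a covering set is tested: its diameter is small enough for the
  counting bound, yet the weight of one vertex is controlled by the gauge. The slack
  \<open>\<eta>\<close> serves sets of diameter 0, whose gauge vanishes for
  \<open>s > 0\<close>.\<close>

lemma scale_for_set:
  fixes U :: "'a::metric_space set" and M m s \<theta> \<eta> :: real
  assumes M: "M > 1" and m: "M powr s \<le> m" "1 < m" and s: "s \<ge> 0" and \<theta>: "\<theta> > 0" and \<eta>: "\<eta> > 0"
    and U: "U \<noteq> {}" "bounded U" "diameter U \<le> \<theta>"
  obtains k where "diameter U \<le> \<theta> / M ^ k"
    "ennreal (1 / m ^ k) \<le> ennreal ((M / \<theta>) powr s) * hausdorff_gauge s U + ennreal \<eta>"
proof -
  define d where "d = diameter U"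
  have d0: "d \<ge> 0" unfolding d_def using U(2) by (rule diameter_ge_0)
  consider "s = 0" | "s > 0" "d = 0" | "s > 0" "d > 0" using s d0 by fastforce
  then show ?thesis
  proof cases
    case 1
    show ?thesis
    proof (rule that[of 0])
      show "ennreal (1 / m ^ 0) \<le> ennreal ((M / \<theta>) powr s) * hausdorff_gauge s U + ennreal \<eta>"
        using U(1) 1 M \<theta> by (simp add: hausdorff_gauge_def)
    qed (use U in simp)
  next
    case 2
    obtain k where "(1 / m) ^ k < \<eta>"
      using real_arch_pow_inv[of \<eta> "1 / m"] m(2) \<eta> by auto
    then have "ennreal (1 / m ^ k) \<le> ennreal \<eta>"
      by (intro ennreal_leI) (simp add: power_one_over)
    then show ?thesis
      using 2 M \<theta> by (intro that[of k]) (auto simp: d_def intro: add_increasing)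
  next
    case 3
    obtain n where "(1 / M) ^ n < d / \<theta>"
      using real_arch_pow_inv[of "d / \<theta>" "1 / M"] M \<theta> 3 by auto
    then have "\<not> d \<le> \<theta> / M ^ n"
      using \<theta> M by (simp add: field_simps power_one_over)
    moreover have "d \<le> \<theta> / M ^ 0" using U by (simp add: d_def)
    \<comment> \<open>The failure at \<open>Suc k\<close> bounds \<open>1 / M ^ k\<close> by
      \<open>M / \<theta> * d\<close>; the constant of the lemma comes from here.\<close>
    ultimately obtain k where k: "d \<le> \<theta> / M ^ k" "\<not> d \<le> \<theta> / M ^ Suc k"
      by (metis dec_induct[of 0 n "\<lambda>k. d \<le> \<theta> / M ^ k"] le0)
    have "1 / m ^ k \<le> 1 / (M powr s) ^ k"
      using m M by (intro divide_left_mono power_mono) auto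
    also have "\<dots> = (1 / M ^ k) powr s"
      using M by (simp add: powr_divide powr_realpow[symmetric] powr_powr mult.commute)
    also have "\<dots> \<le> (M / \<theta> * d) powr s"
    proof (rule powr_mono2)
      show "1 / M ^ k \<le> M / \<theta> * d"
        using k(2) M \<theta> by (simp add: field_simps)
    qed (use M s in auto)
    also have "\<dots> = (M / \<theta>) powr s * d powr s"
      using M \<theta> d0 by (subst powr_mult) auto
    finally have "ennreal (1 / m ^ k) \<le> ennreal ((M / \<theta>) powr s) * ennreal (d powr s)"
      by (simp add: ennreal_mult[symmetric] ennreal_leI)
    also have "\<dots> \<le> ennreal ((M / \<theta>) powr s) * hausdorff_gauge s U + ennreal \<eta>"
      using U 3 by (simp add: hausdorff_gauge_def d_def)
    finally show ?thesis using k(1) that by (simp add: d_def)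
  qed
qed

text \<open>A form of the mass distribution principle. A set tested at level \<open>k\<close> is hit
  with probability at most \<open>B / m ^ k\<close>, which its gauge controls. A cover of small
  total gauge would have total hitting probability below 1 and so miss a branch, hence a point of
  \<open>A\<close>.\<close>

lemma hausdorff_measure_tree_nonzero:
  fixes E :: "'v \<Rightarrow> 'a::metric_space set" and M m s \<theta> :: real
  assumes par: "\<And>v w. v \<in> V \<Longrightarrow> w \<in> ch v \<Longrightarrow> par w = v"
    and ch: "\<And>v. v \<in> V \<Longrightarrow> finite (ch v) \<and> ch v \<subseteq> V \<and> m \<le> real (card (ch v))"
    and r: "r \<in> V"
    and M: "M > 1" and m: "M powr s \<le> m" "1 < m" and s: "s \<ge> 0" and \<theta>: "\<theta> > 0"
    and limit: "\<And>b. \<lbrakk>b 0 = r; \<And>n. b (Suc n) \<in> ch (b n)\<rbrakk> \<Longrightarrow> \<exists>x\<in>A. \<forall>n. x \<in> E (b n)"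
    and count: "\<And>k U. bounded U \<Longrightarrow> diameter U \<le> \<theta> / M ^ k \<Longrightarrow>
      card {w \<in> descendants ch k r. E w \<inter> U \<noteq> {}} \<le> B"
  shows "hausdorff_measure s A \<noteq> 0"
proof
  assume zero: "hausdorff_measure s A = 0"
  define K where "K = (M / \<theta>) powr s"
  \<comment> \<open>Gauges and slacks each contribute at most 1 / (4 * (B + 1)) before the factor
    \<open>B\<close>, so the total stays below 1 / 2.\<close>
  define \<kappa> where "\<kappa> = 1 / (4 * (real B + 1) * K)"
  have K: "K > 0" using M \<theta> by (simp add: K_def)
  have \<kappa>: "\<kappa> > 0" using K by (simp add: \<kappa>_def)
  have "hausdorff_premeasure s \<theta> A \<le> hausdorff_measure s A"
    unfolding hausdorff_measure_def using \<theta> by (intro SUP_upper) auto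
  then have "hausdorff_premeasure s \<theta> A < ennreal \<kappa>"
    using zero \<kappa> by (simp add: ennreal_less_iff)
  then obtain U :: "nat \<Rightarrow> 'a set" where cover: "A \<subseteq> (\<Union>i. U i)"
    and U: "\<And>i. bounded (U i)" "\<And>i. diameter (U i) \<le> \<theta>"
    and sum: "(\<Sum>i. hausdorff_gauge s (U i)) < ennreal \<kappa>"
    unfolding hausdorff_premeasure_def INF_less_iff by auto
  define \<eta> where "\<eta> i = (1 / 2) ^ i / (8 * (real B + 1))" for i :: nat
  have \<eta>: "\<eta> i > 0" for i by (simp add: \<eta>_def)
  have "\<exists>k. diameter (U i) \<le> \<theta> / M ^ k \<and> (U i \<noteq> {} \<longrightarrow>
     ennreal (1 / m ^ k) \<le> ennreal K * hausdorff_gauge s (U i) + ennreal (\<eta> i))" for i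
  proof (cases "U i = {}")
    case True
    then show ?thesis using U(2)[of i] by (intro exI[of _ 0]) simp
  next
    case False
    obtain k where "diameter (U i) \<le> \<theta> / M ^ k"
      "ennreal (1 / m ^ k) \<le> ennreal ((M / \<theta>) powr s) * hausdorff_gauge s (U i) + ennreal (\<eta> i)"
      using scale_for_set[OF M m s \<theta> \<eta>[of i] False U(1) U(2)] by blast
    then show ?thesis unfolding K_def by blast
  qed
  then obtain k where k: "\<And>i. diameter (U i) \<le> \<theta> / M ^ k i"
    "\<And>i. U i \<noteq> {} \<Longrightarrow>
      ennreal (1 / m ^ k i) \<le> ennreal K * hausdorff_gauge s (U i) + ennreal (\<eta> i)"
    by metis
  define P where "P i w \<longleftrightarrow> E w \<inter> U i \<noteq> {}" for i w
  have le: "ennreal (hit_mass ch (P i) (k i) r)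
      \<le> ennreal B * (ennreal K * hausdorff_gauge s (U i) + ennreal (\<eta> i))" for i
  proof (cases "U i = {}")
    case True
    have "hit_mass ch (\<lambda>w. False) d v = 0" for d v
      by (induction d arbitrary: v) auto
    then have "hit_mass ch (P i) (k i) r = 0"
      using True by (simp add: P_def[abs_def])
    then show ?thesis by simp
  next
    case False
    have "hit_mass ch (P i) (k i) r \<le> card {w \<in> descendants ch (k i) r. P i w} / m ^ k i"
      using m(2) by (intro hit_mass_le[of V ch par]) (use par ch r in auto)
    also have "\<dots> \<le> B * (1 / m ^ k i)"
      using count[OF U(1)[of i] k(1)[of i]] m(2) by (simp add: P_def divide_right_mono)
    finally have "ennreal (hit_mass ch (P i) (k i) r) \<le> ennreal B * ennreal (1 / m ^ k i)"
      using m(2) by (simp add: ennreal_mult[symmetric] ennreal_leI)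
    also have "\<dots> \<le> ennreal B * (ennreal K * hausdorff_gauge s (U i) + ennreal (\<eta> i))"
      by (intro mult_left_mono k(2) False) simp
    finally show ?thesis .
  qed
  have "(\<Sum>i. ennreal (\<eta> i)) = ennreal (\<Sum>i. \<eta> i)"
    by (rule suminf_ennreal2) (auto simp: \<eta>_def intro!: summable_divide summable_geometric)
  also have "(\<Sum>i. \<eta> i) = 1 / (4 * (real B + 1))"
    unfolding \<eta>_def by (subst suminf_divide) (auto simp: suminf_geometric summable_geometric field_simps)
  finally have sum\<eta>: "(\<Sum>i. ennreal (\<eta> i)) = ennreal (1 / (4 * (real B + 1)))" .
  have "(\<Sum>i. ennreal (hit_mass ch (P i) (k i) r))
      \<le> (\<Sum>i. ennreal B * (ennreal K * hausdorff_gauge s (U i) + ennreal (\<eta> i)))"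
    by (intro suminf_le le) auto
  also have "\<dots> = ennreal B * (ennreal K * (\<Sum>i. hausdorff_gauge s (U i)) + (\<Sum>i. ennreal (\<eta> i)))"
    by (subst ennreal_suminf_cmult, subst suminf_add[symmetric]) auto
  also have "\<dots> \<le> ennreal B * (ennreal K * ennreal \<kappa> + ennreal (1 / (4 * (real B + 1))))"
    unfolding sum\<eta> using sum by (intro mult_left_mono add_right_mono) auto
  also have "\<dots> = ennreal (B * (K * \<kappa> + 1 / (4 * (real B + 1))))"
    using K \<kappa> by (simp add: ennreal_mult ennreal_plus)
  also have "\<dots> < 1"
  proof -
    have "B * (K * \<kappa> + 1 / (4 * (real B + 1))) < 1"
      using K by (simp add: \<kappa>_def field_simps)
    then show ?thesis by (simp add: ennreal_less_one_iff)
  qed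
  finally have small: "(\<Sum>i. ennreal (hit_mass ch (P i) (k i) r)) < 1" .
  have "finite (ch v) \<and> ch v \<subseteq> V \<and> ch v \<noteq> {}" if "v \<in> V" for v
    using ch[OF that] m(2) by auto
  then obtain b where b: "b 0 = r" "\<And>n. b (Suc n) \<in> ch (b n)" "\<And>i. \<not> P i (b (k i))"
    using avoiding_branch[of V ch r P k] r small by blast
  obtain x where x: "x \<in> A" "\<And>n. x \<in> E (b n)"
    using limit[OF b(1,2)] by blast
  then obtain i where "x \<in> U i" using cover by blast
  then show False using x(2)[of "k i"] b(3)[of i] by (auto simp: P_def)
qed

section \<open>The simplex lemma\<close>

lemma prod_except:
  fixes c :: "'a::comm_monoid_mult"
  assumes "finite A" "h \<in> A"
  shows "(\<Prod>i\<in>A. if i = h then b else c) = b * c ^ (card A - 1)"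
  using assms by (simp add: prod.remove[of A h] card_Diff_singleton)

lemma vec_box_bij:
  "bij_betw (\<lambda>z. ($) z) {z :: 'a ^ 'n::finite. \<forall>i. z $ i \<in> S i} (PiE UNIV S)"
  by (rule bij_betwI[where g = vec_lambda]) (auto simp: PiE_def)

lemma card_vec_box: "card {z :: 'a ^ 'n::finite. \<forall>i. z $ i \<in> S i} = (\<Prod>i\<in>UNIV. card (S i))"
  using bij_betw_same_card[OF vec_box_bij[of S]] by (simp add: card_PiE)

lemma finite_vec_box:
  assumes "\<And>i. finite (S i)"
  shows "finite {z :: 'a ^ 'n::finite. \<forall>i. z $ i \<in> S i}"
  using bij_betw_finite[OF vec_box_bij[of S]] assms by (simp add: finite_PiE)

section \<open>Determinant estimates\<close>

text \<open>Every permutation other than the identity moves some index to a column different from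
  \<open>h\<close>, where it meets a zero off the diagonal.\<close>

lemma det_shear:
  fixes x :: "real ^ 'n::finite"
  shows "det (\<chi> i j. if i = j then 1 else if j = h then x $ i else 0) = 1"
proof -
  let ?T = "\<chi> i j. if i = j then 1 else if j = h then x $ i else 0 :: real ^ 'n ^ 'n"
  let ?t = "\<lambda>p. of_int (sign p) * (\<Prod>i\<in>UNIV. ?T $ i $ p i)"
  have zero: "?t p = 0" if p: "p permutes UNIV" "p \<noteq> id" for p
  proof -
    obtain i where i: "i \<noteq> p i" "p i \<noteq> h"
    proof (cases "p h = h")
      case True
      obtain i where "p i \<noteq> i" using p(2) by (auto simp: fun_eq_iff)
      moreover from this have "p i \<noteq> h"
        using True permutes_inj[OF p(1)] by (metis injD)
      ultimately show ?thesis using that by metis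
    qed (use that in metis)
    then have "?T $ i $ p i = 0" by simp
    then have "(\<Prod>i\<in>UNIV. ?T $ i $ p i) = 0"
      by (intro prod_zero finite bexI[of _ i] UNIV_I)
    then show ?thesis by simp
  qed
  have "det ?T = (\<Sum>p\<in>{p. p permutes UNIV}. ?t p)"
    by (simp add: det_def)
  also have "\<dots> = (\<Sum>p\<in>{id}. ?t p)"
    using zero by (intro sum.mono_neutral_right) (auto simp: permutes_id)
  also have "\<dots> = 1" by simp
  finally show ?thesis .
qed

lemma det_Ints:
  fixes A :: "real ^ 'n::finite ^ 'n"
  assumes "\<And>i j. A $ i $ j \<in> \<int>"
  shows "det A \<in> \<int>"
  unfolding det_def using assms by (intro Ints_sum Ints_mult Ints_prod) auto

text \<open>Each Leibniz term takes one entry from every row. The number of terms is the origin of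
  the factorial in \<open>\<tau>\<close>.\<close>

lemma abs_det_le_prod:
  fixes A :: "real ^ 'n::finite ^ 'n"
  assumes "\<And>i j. \<bar>A $ i $ j\<bar> \<le> \<beta> i"
  shows "\<bar>det A\<bar> \<le> fact CARD('n) * (\<Prod>i\<in>UNIV. \<beta> i)"
proof -
  have "\<bar>det A\<bar> \<le> (\<Sum>p\<in>{p. p permutes (UNIV :: 'n set)}. \<bar>of_int (sign p) * (\<Prod>i\<in>UNIV. A $ i $ p i)\<bar>)"
    unfolding det_def by (rule sum_abs)
  also have "\<dots> \<le> (\<Sum>p\<in>{p. p permutes (UNIV :: 'n set)}. \<Prod>i\<in>UNIV. \<beta> i)"
  proof (rule sum_mono)
    fix p :: "'n \<Rightarrow> 'n"
    have "\<bar>real_of_int (sign p)\<bar> = 1" by (simp add: sign_def)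
    moreover have "(\<Prod>i\<in>UNIV. \<bar>A $ i $ p i\<bar>) \<le> (\<Prod>i\<in>UNIV. \<beta> i)"
      using assms by (intro prod_mono) auto
    ultimately show "\<bar>of_int (sign p) * (\<Prod>i\<in>UNIV. A $ i $ p i)\<bar> \<le> (\<Prod>i\<in>UNIV. \<beta> i)"
      by (simp only: abs_mult abs_prod mult_1)
  qed
  also have "\<dots> = fact CARD('n) * (\<Prod>i\<in>UNIV. \<beta> i)"
    using card_permutations[OF refl, of "UNIV :: 'n set"] by simp
  finally show ?thesis .
qed

text \<open>
  Any \<open>CARD('n)\<close> vectors in \<open>R\<close> form an integer matrix; after shearing by \<open>x\<close>, the row bounds
  force its determinant to be smaller than 1, hence zero.
\<close>

lemma simplex_lemma:
  fixes x :: "real ^ 'n::finite" and h :: 'n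
  assumes small: "fact CARD('n) * (Q * \<rho> ^ (CARD('n) - 1)) < 1"
    and R: "\<And>q. q \<in> R \<Longrightarrow>
      \<bar>real_of_int (q $ h)\<bar> \<le> Q \<and> (\<forall>i. i \<noteq> h \<longrightarrow> \<bar>of_int (q $ i) - of_int (q $ h) * x $ i\<bar> \<le> \<rho>)"
  obtains a where "a \<noteq> 0" "\<And>q. q \<in> R \<Longrightarrow> a \<bullet> real_vec q = 0"
\<comment> \<open>If the vectors do not span, a normal of their span works. Otherwise
  \<open>R\<close> contains a basis, whose determinant gives a contradiction.\<close>
proof (cases "span (real_vec ` R) = UNIV")
  case False
  then obtain a where "a \<noteq> 0" "\<forall>v\<in>span (real_vec ` R). a \<bullet> v = 0"
    using span_not_UNIV_orthogonal[of "real_vec ` R"] by blast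
  then show ?thesis
    using that by (meson image_eqI span_base)
next
  case True
  obtain B where B: "B \<subseteq> real_vec ` R" "independent B" "real_vec ` R \<subseteq> span B"
    by (rule maximal_independent_subset)
  have "span B = UNIV"
    using True B(3) by (metis span_minimal subspace_span top.extremum_uniqueI)
  then have "card B = CARD('n)"
    using B(2) by (metis dim_UNIV dim_eq_card dim_span DIM_cart DIM_real mult_1_right)
  then obtain f where f: "bij_betw f (UNIV :: 'n set) B"
    using bij_betw_iff_card[of "UNIV :: 'n set" B] independent_imp_finite[OF B(2)] by auto
  \<comment> \<open>The vectors become columns, so that bounds on their coordinates are row bounds.
    Multiplying by \<open>T\<close> on the left subtracts \<open>x $ i\<close> times row
    \<open>h\<close> from row \<open>i\<close>.\<close>
  define A :: "real ^ 'n ^ 'n" where "A = transpose (\<chi> l. f l)"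
  define T :: "real ^ 'n ^ 'n"
    where "T = (\<chi> i j. if i = j then 1 else if j = h then (- x) $ i else 0)"
  have "rows (\<chi> l. f l) = B"
    using f by (auto simp: rows_def row_def bij_betw_def)
  then have "det A \<noteq> 0"
    using \<open>span B = UNIV\<close> unfolding A_def det_transpose
    by (metis invertible_det_nz invertible_left_inverse matrix_left_invertible_span_rows)
  have fR: "\<exists>q\<in>R. f l = real_vec q" for l
    using f B(1) by (auto simp: bij_betw_def)
  have "A $ i $ l \<in> \<int>" for i l
    using fR[of l] by (auto simp: A_def transpose_def real_vec_def)
  then have "det A \<in> \<int>"
    by (rule det_Ints)
  with \<open>det A \<noteq> 0\<close> have ge: "1 \<le> \<bar>det A\<bar>"
    by (metis Ints_nonzero_abs_ge1)
  have entry: "(T ** A) $ i $ l = (if i = h then f l $ h else f l $ i - f l $ h * x $ i)" for i l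
  proof -
    have "(T ** A) $ i $ l = (\<Sum>k\<in>UNIV. T $ i $ k * f l $ k)"
      by (simp add: matrix_matrix_mult_def A_def transpose_def)
    also have "\<dots> = (\<Sum>k\<in>UNIV. (if k = i then f l $ i else 0)
        + (if k = h then (if i = h then 0 else - (x $ i * f l $ h)) else 0))"
      by (intro sum.cong refl) (auto simp: T_def)
    also have "\<dots> = (if i = h then f l $ h else f l $ i - f l $ h * x $ i)"
      by (simp add: sum.distrib mult.commute)
    finally show ?thesis .
  qed
  have bound: "\<bar>(T ** A) $ i $ l\<bar> \<le> (if i = h then Q else \<rho>)" for i l
    using fR[of l] R unfolding entry by (auto simp: real_vec_def)
  have "\<bar>det (T ** A)\<bar> \<le> fact CARD('n) * (\<Prod>i\<in>UNIV. if i = h then Q else \<rho>)"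
    by (rule abs_det_le_prod[OF bound])
  also have "(\<Prod>i\<in>UNIV. if i = h then Q else \<rho>) = Q * \<rho> ^ (CARD('n) - 1)"
    by (simp add: prod.If_cases Compl_eq_Diff_UNIV card_Diff_singleton)
  finally have "\<bar>det (T ** A)\<bar> < 1"
    using small by simp
  moreover have "det (T ** A) = det A"
    unfolding det_mul T_def det_shear by simp
  ultimately show ?thesis using ge by simp
qed

section \<open>The dimension of projective space\<close>

lemma dist_proj_of_le:
  fixes x y :: "real ^ 'n::finite"
  assumes "norm x \<ge> 1" "y \<noteq> 0"
  shows "dist (proj_of x) (proj_of y) \<le> norm (x - y)"
proof -
  have x: "x \<noteq> 0" using assms(1) by auto
  have "dist (proj_of x) (proj_of y) \<le> norm (x - y) * norm y / (norm x * norm y)"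
    unfolding dist_proj_of[OF x assms(2)]
    using wedge_norm_le[of x y 1] by (intro divide_right_mono) auto
  also have "\<dots> = norm (x - y) / norm x" using assms(2) by simp
  also have "\<dots> \<le> norm (x - y)"
    using assms(1) by (simp add: divide_le_eq mult_le_cancel_left1)
  finally show ?thesis .
qed

text \<open>Off the diagonal each entry occurs twice up to sign, which makes up for the division by
  2 in \<open>wedge_norm\<close>. With one coordinate equal to 1, distances thereby control
  coordinate differences and the errors \<open>q $ i - q $ h * x $ i\<close>.\<close>

lemma wedge_entry_le: "\<bar>x $ i * y $ j - x $ j * y $ i\<bar> \<le> wedge_norm x y"
proof (cases "i = j")
  case False
  define g where "g k = (\<Sum>l\<in>UNIV. (wedge x y $ k $ l)\<^sup>2)" for k
  have g: "(wedge x y $ k $ l)\<^sup>2 \<le> g k" for k l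
    unfolding g_def by (rule member_le_sum) auto
  have "g i + g j = sum g {i, j}" using False by simp
  also have "\<dots> \<le> sum g UNIV"
    by (intro sum_mono2) (auto simp: g_def intro: sum_nonneg)
  finally have "(wedge x y $ i $ j)\<^sup>2 + (wedge x y $ j $ i)\<^sup>2 \<le> sum g UNIV"
    using g[of i j] g[of j i] by linarith
  moreover have "wedge x y $ i $ j = x $ i * y $ j - x $ j * y $ i"
    "wedge x y $ j $ i = - (x $ i * y $ j - x $ j * y $ i)"
    by (simp_all add: wedge_def)
  ultimately have "(x $ i * y $ j - x $ j * y $ i)\<^sup>2 \<le> sum g UNIV / 2"
    by (simp only: power2_minus)
  then have "sqrt ((x $ i * y $ j - x $ j * y $ i)\<^sup>2) \<le> sqrt (sum g UNIV / 2)"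
    by (rule real_sqrt_le_mono)
  then show ?thesis by (simp add: wedge_norm_def g_def)
qed (simp add: wedge_norm_nonneg)

lemma norm_le_card:
  fixes x :: "real ^ 'n::finite" and c :: real
  assumes "\<And>i. \<bar>x $ i\<bar> \<le> c"
  shows "norm x \<le> CARD('n) * c"
  using norm_le_l1_cart[of x] sum_mono[of UNIV "\<lambda>i. \<bar>x $ i\<bar>" "\<lambda>_. c"] assms by simp

section \<open>The upper bound on the dimension\<close>

text \<open>For \<open>s > t\<close> the n-th cover costs at most
  \<open>c * D powr s * n powr (t - s)\<close>, which tends to 0.\<close>

lemma hausdorff_dim_le_if_covers:
  fixes A :: "'a::metric_space set" and c D t :: real
  assumes t: "t \<ge> 0" and c: "c \<ge> 0" and D: "D \<ge> 0"
    and cover: "\<And>n. n > 0 \<Longrightarrow> \<exists>F. finite F \<and> A \<subseteq> \<Union>F \<and> card F \<le> c * real n powr t \<and>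
      (\<forall>U\<in>F. bounded U \<and> diameter U \<le> D / n)"
  shows "hausdorff_dim A \<le> ereal t"
proof -
  have zero: "hausdorff_measure s A = 0" if s: "s > t" for s
  proof -
    have "hausdorff_premeasure s \<delta> A \<le> 0" if \<delta>: "\<delta> > 0" for \<delta>
    proof (rule tendsto_lowerbound)
      have "((\<lambda>n::nat. real n powr (t - s)) \<longlongrightarrow> 0) sequentially"
        using s by (intro tendsto_neg_powr filterlim_real_sequentially) auto
      then have "((\<lambda>n::nat. c * D powr s * real n powr (t - s)) \<longlongrightarrow> c * D powr s * 0) sequentially"
        by (intro tendsto_intros)
      then show "((\<lambda>n::nat. ennreal (c * D powr s * real n powr (t - s))) \<longlongrightarrow> 0) sequentially"
        by (metis ennreal_0 mult_zero_right tendsto_ennrealI)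
      have "((\<lambda>n::nat. D / real n) \<longlongrightarrow> 0) sequentially"
        by (rule tendsto_divide_0[OF tendsto_const])
          (simp add: filterlim_at_top_imp_at_infinity filterlim_real_sequentially)
      then have "\<forall>\<^sub>F n in sequentially. D / real n < \<delta>"
        using \<delta> by (rule order_tendstoD(2))
      then show "\<forall>\<^sub>F n in sequentially.
          hausdorff_premeasure s \<delta> A \<le> ennreal (c * D powr s * real n powr (t - s))"
        using eventually_gt_at_top[of 0]
      proof eventually_elim
        case (elim n)
        obtain F where F: "finite F" "A \<subseteq> \<Union>F" "card F \<le> c * real n powr t"
          "\<And>U. U \<in> F \<Longrightarrow> bounded U \<and> diameter U \<le> D / n"
          using cover[OF elim(2)] by blast
        define m where "m = card F"
        obtain f where f: "bij_betw f {..<m} F"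
          using ex_bij_betw_nat_finite[OF F(1)] by (auto simp: m_def atLeast0LessThan)
        \<comment> \<open>Padding the finite cover to a sequence is free, as empty sets have gauge
          0.\<close>
        define U where "U i = (if i < m then f i else {})" for i
        have UF: "U i \<in> F" if "i < m" for i
          using that f by (auto simp: U_def bij_betw_def)
        have "\<Union>F = (\<Union>i<m. f i)"
          using f by (auto simp: bij_betw_def)
        also have "\<dots> = (\<Union>i<m. U i)" by (simp add: U_def)
        also have "\<dots> \<subseteq> (\<Union>i. U i)" by blast
        finally have "\<Union>F \<subseteq> (\<Union>i. U i)" .
        with F(2) have "A \<subseteq> (\<Union>i. U i)" by (rule subset_trans)
        moreover have "bounded (U i) \<and> diameter (U i) \<le> \<delta>" for i
        proof (cases "i < m")
          case True
          then show ?thesis using F(4)[OF UF] elim(1) by fastforce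
        qed (use \<delta> in \<open>simp add: U_def\<close>)
        ultimately have "hausdorff_premeasure s \<delta> A \<le> (\<Sum>i. hausdorff_gauge s (U i))"
          unfolding hausdorff_premeasure_def by (intro INF_lower) auto
        also have "\<dots> = (\<Sum>i<m. hausdorff_gauge s (U i))"
          by (rule suminf_finite) (auto simp: U_def hausdorff_gauge_def)
        also have "\<dots> \<le> (\<Sum>i<m. ennreal ((D / n) powr s))"
        proof (rule sum_mono)
          fix i assume "i \<in> {..<m}"
          then have "bounded (U i)" "diameter (U i) \<le> D / n"
            using F(4)[OF UF] by auto
          then have "diameter (U i) powr s \<le> (D / n) powr s"
            using s t by (intro powr_mono2 diameter_ge_0) auto
          then show "hausdorff_gauge s (U i) \<le> ennreal ((D / n) powr s)"
            using s t by (simp add: hausdorff_gauge_def ennreal_leI)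
        qed
        also have "\<dots> = ennreal (m * (D / n) powr s)"
          by (simp add: ennreal_mult ennreal_of_nat_eq_real_of_nat)
        also have "\<dots> \<le> ennreal (c * D powr s * real n powr (t - s))"
        proof (rule ennreal_leI)
          have "m * (D / n) powr s \<le> (c * real n powr t) * (D / n) powr s"
            using F(3) by (intro mult_right_mono) (auto simp: m_def)
          also have "\<dots> = c * D powr s * real n powr (t - s)"
            using D by (simp add: powr_divide powr_diff)
          finally show "m * (D / n) powr s \<le> c * D powr s * real n powr (t - s)" .
        qed
        finally show ?case .
      qed
    qed simp
    then show ?thesis
      unfolding hausdorff_measure_def by (intro antisym SUP_least) auto
  qed
  show ?thesis
  proof (rule ereal_le_epsilon2)
    fix e :: real assume "e > 0"
    then have "t + e \<in> {s. s \<ge> 0 \<and> hausdorff_measure s A = 0}"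
      using zero t by simp
    then have "hausdorff_dim A \<le> ereal (t + e)"
      unfolding hausdorff_dim_def by (intro Inf_lower imageI)
    then show "hausdorff_dim A \<le> ereal t + ereal e" by simp
  qed
qed

lemma bounded_diameter_le:
  fixes S :: "'a::metric_space set"
  assumes "d \<ge> 0" "\<And>x y. x \<in> S \<Longrightarrow> y \<in> S \<Longrightarrow> dist x y \<le> d"
  shows "bounded S \<and> diameter S \<le> d"
proof
  show "bounded S" unfolding bounded_def using assms(2) by blast
  show "diameter S \<le> d"
    using assms by (auto simp: diameter_def intro!: cSUP_least)
qed

text \<open>Division by a coordinate of largest modulus moves every point into one of finitely many
  charts with coordinates in [-1, 1]; each chart is cut into boxes of side
  \<open>1 / n\<close>.\<close>

lemma hausdorff_dim_proj_le:
  "hausdorff_dim (A :: ('n::finite) proj set) \<le> ereal (real (CARD('n) - 1))"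
proof (rule hausdorff_dim_le_if_covers)
  let ?N = "CARD('n) - 1"
  fix n :: nat assume n: "n > 0"
  \<comment> \<open>The label at \<open>h\<close> is a dummy. The others are floors; the value
    \<open>n\<close> occurs when a coordinate equals 1, hence 2 * n + 1 labels, at most 3 *
    n.\<close>
  define S :: "'n \<Rightarrow> 'n \<Rightarrow> int set" where "S h i = (if i = h then {0} else {- int n..int n})" for h i
  define I where "I = Sigma UNIV (\<lambda>h. {z :: int ^ 'n. \<forall>i. z $ i \<in> S h i})"
  define box where "box h z = {x :: real ^ 'n. x $ h = 1 \<and>
      (\<forall>i. i \<noteq> h \<longrightarrow> of_int (z $ i) \<le> n * x $ i \<and> n * x $ i \<le> of_int (z $ i) + 1)}" for h and z :: "int ^ 'n"
  define F where "F = (\<lambda>(h, z). proj_of ` box h z) ` I"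
  have finS: "finite {z :: int ^ 'n. \<forall>i. z $ i \<in> S h i}" for h
    by (rule finite_vec_box) (simp add: S_def)
  then have finI: "finite I"
    unfolding I_def by (intro finite_SigmaI) auto
  have "card I = (\<Sum>h\<in>UNIV. card {z :: int ^ 'n. \<forall>i. z $ i \<in> S h i})"
    unfolding I_def using finS by (intro card_SigmaI) auto
  also have "\<dots> = (\<Sum>h\<in>(UNIV :: 'n set). (2 * n + 1) ^ ?N)"
  proof (rule sum.cong)
    fix h :: 'n
    have "(\<Prod>i\<in>UNIV. card (S h i)) = (\<Prod>i\<in>UNIV. if i = h then 1 else 2 * n + 1)"
      by (intro prod.cong) (auto simp: S_def)
    also have "\<dots> = (2 * n + 1) ^ ?N"
      by (subst prod_except) auto
    finally show "card {z :: int ^ 'n. \<forall>i. z $ i \<in> S h i} = (2 * n + 1) ^ ?N"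
      unfolding card_vec_box .
  qed simp
  finally have cardI: "card I = CARD('n) * (2 * n + 1) ^ ?N" by simp
  have "finite F" using finI by (simp add: F_def)
  moreover have "A \<subseteq> \<Union>F"
  proof
    fix p assume "p \<in> A"
    obtain x where x: "x \<noteq> 0" "p = proj_of x" by (rule proj_cases)
    have "Max (range (\<lambda>i. \<bar>x $ i\<bar>)) \<in> range (\<lambda>i. \<bar>x $ i\<bar>)"
      by (intro Max_in) auto
    then obtain h where eq: "Max (range (\<lambda>i. \<bar>x $ i\<bar>)) = \<bar>x $ h\<bar>" by blast
    have h: "\<bar>x $ i\<bar> \<le> \<bar>x $ h\<bar>" for i
      unfolding eq[symmetric] by (intro Max_ge) auto
    have xh: "x $ h \<noteq> 0"
    proof
      assume "x $ h = 0"
      then have "x $ i = 0" for i using h[of i] by simp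
      then show False using x(1) by (simp add: vec_eq_iff)
    qed
    define y where "y = (1 / x $ h) *\<^sub>R x"
    have y1: "y $ h = 1" using xh by (simp add: y_def)
    have yi: "\<bar>y $ i\<bar> \<le> 1" for i
      using h[of i] xh by (simp add: y_def abs_divide)
    have "y \<noteq> 0" using y1 by auto
    then have "proj_of x = proj_of y"
      using proj_of_eq_iff[OF x(1), of y] xh
      by (auto simp: y_def intro!: exI[of _ "x $ h"])
    define z where "z = (\<chi> i. if i = h then 0 else \<lfloor>n * y $ i\<rfloor>)"
    have "z $ i \<in> S h i" for i
    proof -
      have "n * \<bar>y $ i\<bar> \<le> real n * 1" by (rule mult_left_mono[OF yi]) simp
      then have "\<bar>n * y $ i\<bar> \<le> n" by (simp add: abs_mult)
      then have "real_of_int (- int n) \<le> n * y $ i" "n * y $ i \<le> real n" by auto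
      then have "- int n \<le> \<lfloor>n * y $ i\<rfloor>" "\<lfloor>n * y $ i\<rfloor> \<le> int n"
        unfolding le_floor_iff floor_le_iff by auto
      then show ?thesis by (simp add: z_def S_def)
    qed
    then have "(h, z) \<in> I" by (simp add: I_def)
    moreover have "y \<in> box h z"
      using y1 by (auto simp: box_def z_def)
    ultimately show "p \<in> \<Union>F"
      unfolding F_def x(2) \<open>proj_of x = proj_of y\<close> by blast
  qed
  moreover have "card F \<le> (CARD('n) * 3 ^ ?N) * real n powr real ?N"
  proof -
    have "card F \<le> card I" unfolding F_def by (rule card_image_le[OF finI])
    also have "\<dots> \<le> CARD('n) * (3 * n) ^ ?N"
      unfolding cardI using n by (intro mult_left_mono power_mono) auto
    finally have "real (card F) \<le> real (CARD('n) * (3 * n) ^ ?N)" by (rule of_nat_mono)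
    also have "\<dots> = (CARD('n) * 3 ^ ?N) * real n ^ ?N" by (simp add: power_mult_distrib)
    also have "real n ^ ?N = real n powr real ?N" using n by (intro powr_realpow[symmetric]) simp
    finally show ?thesis .
  qed
  moreover have "bounded U \<and> diameter U \<le> CARD('n) / n" if UF: "U \<in> F" for U
  proof -
    obtain h z where U: "U = proj_of ` box h z"
      using UF by (auto simp: F_def)
    have "dist (proj_of x) (proj_of y) \<le> CARD('n) / n" if "x \<in> box h z" "y \<in> box h z" for x y
    proof -
      have "1 \<le> norm x" "y \<noteq> 0"
        using that component_le_norm_cart[of x h] by (auto simp: box_def)
      then have "dist (proj_of x) (proj_of y) \<le> norm (x - y)" by (rule dist_proj_of_le)
      also have "\<dots> \<le> CARD('n) * (1 / n)"
      proof (rule norm_le_card)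
        fix i
        show "\<bar>(x - y) $ i\<bar> \<le> 1 / n"
        proof (cases "i = h")
          case False
          then have "of_int (z $ i) \<le> n * x $ i" "n * x $ i \<le> of_int (z $ i) + 1"
            "of_int (z $ i) \<le> n * y $ i" "n * y $ i \<le> of_int (z $ i) + 1"
            using that by (auto simp: box_def)
          then have "\<bar>n * x $ i - n * y $ i\<bar> \<le> 1" by linarith
          moreover have "\<bar>n * x $ i - n * y $ i\<bar> = n * \<bar>(x - y) $ i\<bar>"
            by (simp add: right_diff_distrib[symmetric] abs_mult)
          ultimately show ?thesis using n by (simp add: field_simps)
        qed (use that in \<open>simp add: box_def\<close>)
      qed
      finally show ?thesis by simp
    qed
    then show ?thesis unfolding U by (intro bounded_diameter_le) auto
  qed
  ultimately show "\<exists>F. finite F \<and> A \<subseteq> \<Union>F \<and> card F \<le> (CARD('n) * 3 ^ ?N) * real n powr real ?N \<and>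
      (\<forall>U\<in>F. bounded U \<and> diameter U \<le> CARD('n) / n)"
    by blast
qed auto

section \<open>A tree of cubes avoiding rational points\<close>

locale cube_tree =
  fixes h :: "'n::finite" and L :: nat
  assumes L: "L \<ge> 2" and card_ge_2: "CARD('n) \<ge> 2"
begin

definition N :: nat where "N = CARD('n) - 1"

text \<open>
  Cubes of level \<open>k\<close> have side \<open>1 / M ^ k\<close> and are compared with the rational points whose height
  lies between \<open>\<tau> * L ^ (N * k)\<close> and \<open>\<tau> * L ^ (N * (k + 1))\<close>. As \<open>M\<close> is a power of \<open>L\<close>, the scale
  \<open>L ^ k\<close> is comparable to the \<open>N\<close>-th root of these heights. The factor \<open>\<tau>\<close> makes the simplex
  lemma applicable.
\<close>

definition M :: nat where "M = L ^ CARD('n)"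
definition \<tau> :: real where "\<tau> = 1 / (2 * fact CARD('n) * real L ^ N)"

lemma N: "N \<ge> 1" "CARD('n) = Suc N"
  using card_ge_2 by (auto simp: N_def)

lemma M_eq: "M = L ^ N * L"
  by (simp add: M_def N)

lemma M_ge_L: "M \<ge> L"
  unfolding M_eq using L by simp

lemma M_ge_2: "M \<ge> 2"
  using M_ge_L L by simp

lemma \<tau>: "\<tau> > 0" "\<tau> \<le> 1"
proof -
  show "\<tau> > 0" using L by (simp add: \<tau>_def)
  have "1 * 1 \<le> fact CARD('n) * real L ^ N"
    using L by (intro mult_mono fact_ge_1 one_le_power) auto
  then show "\<tau> \<le> 1" using L by (simp add: \<tau>_def divide_le_eq)
qed

text \<open>
  The coordinate \<open>h\<close> is fixed to 1: cubes live in an affine chart of projective space.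
\<close>

definition cube :: "nat \<Rightarrow> int ^ 'n \<Rightarrow> (real ^ 'n) set" where
  "cube k z = cbox (\<chi> i. if i = h then 1 else of_int (z $ i) / real M ^ k)
     (\<chi> i. if i = h then 1 else (of_int (z $ i) + 1) / real M ^ k)"

lemma mem_cube:
  "x \<in> cube k z \<longleftrightarrow> x $ h = 1 \<and>
    (\<forall>i. i \<noteq> h \<longrightarrow> of_int (z $ i) \<le> M ^ k * x $ i \<and> M ^ k * x $ i \<le> of_int (z $ i) + 1)"
proof -
  have "real M ^ k > 0" using M_ge_2 by simp
  then show ?thesis
    unfolding cube_def mem_box_cart
    by (auto simp: divide_le_eq le_divide_eq mult.commute split: if_splits)
qed

definition subcells :: "int ^ 'n \<Rightarrow> (int ^ 'n) set" where
  "subcells z = {w. \<forall>i. w $ i \<in> (if i = h then {0} else {M * z $ i..<M * z $ i + M})}"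

text \<open>Coordinate \<open>h\<close> carries no information; fixing it at 0 makes labels unique,
  so that \<open>parent\<close> can undo a subdivision.\<close>

definition nodes :: "(nat \<times> (int ^ 'n)) set" where
  "nodes = {(k, z). z $ h = 0 \<and> (\<forall>i. 0 \<le> z $ i \<and> z $ i < int (M ^ k))}"

text \<open>The approximation is cleared of denominators: if \<open>\<bar>q $ h\<bar>\<close> is at
  least \<open>\<tau> * L ^ (N * k)\<close>, it puts \<open>x\<close> within
  \<open>1 / M ^ Suc k\<close> of the rational point in every coordinate. The height windows for
  successive \<open>k\<close> adjoin each other.\<close>

definition hit_by :: "nat \<Rightarrow> int ^ 'n \<Rightarrow> real ^ 'n \<Rightarrow> bool" where
  "hit_by k q x \<longleftrightarrow> (\<forall>i. \<bar>of_int (q $ i)\<bar> < \<tau> * real L ^ (N * Suc k)) \<and>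
     (\<exists>i. \<tau> * real L ^ (N * k) \<le> \<bar>of_int (q $ i)\<bar>) \<and>
     (\<forall>i. i \<noteq> h \<longrightarrow> \<bar>of_int (q $ i) - of_int (q $ h) * x $ i\<bar> < \<tau> / M / real L ^ k)"

text \<open>Window \<open>k\<close> is tested on cubes of level \<open>Suc k\<close>, since their
  side matches the width of the forbidden slab.\<close>

definition hit :: "nat \<Rightarrow> int ^ 'n \<Rightarrow> bool" where
  "hit k w \<longleftrightarrow> (\<exists>x\<in>cube (Suc k) w. \<exists>q. hit_by k q x)"

definition children :: "nat \<times> (int ^ 'n) \<Rightarrow> (nat \<times> (int ^ 'n)) set" where
  "children v = Pair (Suc (fst v)) ` {w \<in> subcells (snd v). \<not> hit (fst v) w}"

definition parent :: "nat \<times> (int ^ 'n) \<Rightarrow> nat \<times> (int ^ 'n)" where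
  "parent v = (fst v - 1, \<chi> i. snd v $ i div M)"

section \<open>Nesting of the cubes\<close>

lemma cube_subset:
  assumes "w \<in> subcells z"
  shows "cube (Suc k) w \<subseteq> cube k z"
proof
  fix x assume x: "x \<in> cube (Suc k) w"
  have M0: "real M > 0" using M_ge_2 by simp
  have "of_int (z $ i) \<le> M ^ k * x $ i \<and> M ^ k * x $ i \<le> of_int (z $ i) + 1" if "i \<noteq> h" for i
  proof -
    have "int M * z $ i \<le> w $ i" "w $ i + 1 \<le> int M * z $ i + int M"
      using assms that by (auto simp: subcells_def dest!: spec[of _ i])
    then have "real_of_int (int M * z $ i) \<le> w $ i" "real_of_int (w $ i + 1) \<le> int M * z $ i + int M"
      unfolding of_int_le_iff by auto
    moreover have "of_int (w $ i) \<le> M * (M ^ k * x $ i)" "M * (M ^ k * x $ i) \<le> of_int (w $ i) + 1"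
      using x that by (auto simp: mem_cube mult.assoc)
    ultimately have "M * real_of_int (z $ i) \<le> M * (M ^ k * x $ i)"
      "M * (M ^ k * x $ i) \<le> M * (real_of_int (z $ i) + 1)"
      unfolding of_int_add of_int_mult of_int_of_nat_eq distrib_left by linarith+
    then show ?thesis using M0 by (metis mult_le_cancel_left_pos)
  qed
  then show "x \<in> cube k z" using x by (simp add: mem_cube)
qed

lemma cube_unit:
  assumes "(k, z) \<in> nodes" "x \<in> cube k z"
  shows "0 \<le> x $ i" "x $ i \<le> 1"
proof -
  have M0: "real M ^ k > 0" using M_ge_2 by simp
  have "0 \<le> x $ i \<and> x $ i \<le> 1"
  proof (cases "i = h")
    case False
    have "0 \<le> z $ i" "z $ i + 1 \<le> int (M ^ k)"
      using assms(1) by (auto simp: nodes_def dest!: spec[of _ i])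
    then have "0 \<le> real_of_int (z $ i)" "real_of_int (z $ i + 1) \<le> real_of_int (int (M ^ k))"
      unfolding of_int_le_iff by auto
    moreover have "of_int (z $ i) \<le> M ^ k * x $ i" "M ^ k * x $ i \<le> of_int (z $ i) + 1"
      using assms(2) False by (auto simp: mem_cube)
    ultimately have "real M ^ k * 0 \<le> real M ^ k * x $ i" "real M ^ k * x $ i \<le> real M ^ k * 1"
      by auto
    then show ?thesis using M0 by (meson mult_left_le_imp_le)
  qed (use assms(2) in \<open>simp add: mem_cube\<close>)
  then show "0 \<le> x $ i" "x $ i \<le> 1" by auto
qed

lemma subcells_nodes:
  assumes "(k, z) \<in> nodes" "w \<in> subcells z"
  shows "(Suc k, w) \<in> nodes"
proof -
  have "0 \<le> w $ i \<and> w $ i < int (M ^ Suc k)" for i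
  proof (cases "i = h")
    case True
    then show ?thesis using assms(2) M_ge_2 by (auto simp: subcells_def dest!: spec[of _ h])
  next
    case False
    have z: "0 \<le> z $ i" "z $ i + 1 \<le> int (M ^ k)"
      using assms(1) by (auto simp: nodes_def dest!: spec[of _ i])
    have w: "int M * z $ i \<le> w $ i" "w $ i < int M * (z $ i + 1)"
      using assms(2) False by (auto simp: subcells_def distrib_left dest!: spec[of _ i])
    have "0 \<le> int M * z $ i" using z by simp
    moreover have "int M * (z $ i + 1) \<le> int M * int (M ^ k)"
      using z by (intro mult_left_mono) auto
    ultimately show ?thesis using w by simp
  qed
  moreover have "w $ h = 0" using assms(2) by (auto simp: subcells_def dest!: spec[of _ h])
  ultimately show ?thesis by (simp add: nodes_def)
qed

lemma parent_children:
  assumes "v \<in> nodes" "w \<in> children v"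
  shows "parent w = v"
proof -
  obtain k z u where v: "v = (k, z)" "w = (Suc k, u)" "u \<in> subcells z"
    using assms(2) by (cases v) (auto simp: children_def)
  have "u $ i div int M = z $ i" for i
  proof (cases "i = h")
    case True
    then show ?thesis
      using assms(1) v by (auto simp: subcells_def nodes_def dest!: spec[of _ h])
  next
    case False
    then have "int M * z $ i \<le> u $ i" "u $ i < int M * z $ i + int M"
      using v(3) by (auto simp: subcells_def dest!: spec[of _ i])
    then show ?thesis
      by (intro int_div_pos_eq[of _ _ _ "u $ i - int M * z $ i"]) auto
  qed
  then show ?thesis by (simp add: v parent_def vec_eq_iff)
qed

section \<open>The slab of hit points\<close>

text \<open>As \<open>x\<close> has coordinates in [0, 1], \<open>\<bar>q $ i\<bar>\<close> is below
  \<open>\<bar>q $ h\<bar> + 1\<close>; integrality then makes \<open>q $ h\<close> largest in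
  modulus.\<close>

lemma hit_height:
  assumes "(k, z) \<in> nodes" "x \<in> cube k z" "hit_by k' q x"
  shows "\<tau> * real L ^ (N * k') \<le> \<bar>of_int (q $ h)\<bar>"
proof -
  obtain i where i: "\<tau> * real L ^ (N * k') \<le> \<bar>of_int (q $ i)\<bar>"
    using assms(3) by (auto simp: hit_by_def)
  show ?thesis
  proof (cases "i = h")
    case False
    have "1 * 1 \<le> M * real L ^ k'"
      using L M_ge_2 by (intro mult_mono one_le_power) auto
    then have "\<tau> / M / real L ^ k' \<le> 1"
      using \<tau> L M_ge_2 by (simp add: divide_le_eq)
    then have "\<bar>of_int (q $ i) - of_int (q $ h) * x $ i\<bar> < 1"
      using assms(3) False by (auto simp: hit_by_def dest!: spec[of _ i])
    moreover have "\<bar>of_int (q $ h) * x $ i\<bar> \<le> \<bar>real_of_int (q $ h)\<bar>"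
      using cube_unit[OF assms(1,2), of i] by (simp add: abs_mult mult_left_le)
    ultimately have "\<bar>real_of_int (q $ i)\<bar> < \<bar>real_of_int (q $ h)\<bar> + 1" by linarith
    then have "\<bar>q $ i\<bar> \<le> \<bar>q $ h\<bar>" by linarith
    then show ?thesis using i by linarith
  qed (use i in simp)
qed

lemma hit_hyperplane:
  assumes "(k, z) \<in> nodes"
  obtains a where "a \<noteq> 0" "\<And>x q. x \<in> cube k z \<Longrightarrow> hit_by k q x \<Longrightarrow> a \<bullet> real_vec q = 0"
proof -
  let ?R = "{q. \<exists>x\<in>cube k z. hit_by k q x}"
  define y :: "real ^ 'n" where "y = (\<chi> i. if i = h then 1 else of_int (z $ i) / real M ^ k)"
  define T where "T = \<tau> * real L ^ N"
  have L0: "real L > 0" and M0: "real M > 0" using L M_ge_2 by auto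
  have T: "T = 1 / (2 * fact CARD('n))" using L0 by (simp add: T_def \<tau>_def)
  have T0: "T > 0" by (simp add: T)
  have y: "y \<in> cube k z" using M0 by (simp add: mem_cube y_def)
  have dx: "\<bar>x $ i - y $ i\<bar> \<le> 1 / real M ^ k" if "x \<in> cube k z" for x i
  proof (cases "i = h")
    case False
    then have "\<bar>M ^ k * x $ i - M ^ k * y $ i\<bar> \<le> 1"
      using that y unfolding mem_cube by (smt (verit))
    then have "real M ^ k * \<bar>x $ i - y $ i\<bar> \<le> 1"
      by (simp add: right_diff_distrib[symmetric] abs_mult)
    then show ?thesis using M0 by (simp add: field_simps)
  qed (use that M0 y in \<open>simp add: mem_cube\<close>)
  have MT: "\<tau> * real L ^ (N * Suc k) / real M ^ k = T / real L ^ k"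
    using L0 by (simp add: T_def M_eq power_mult_distrib power_mult power_add)
  have "\<tau> / M \<le> T"
  proof -
    have "\<tau> / M \<le> \<tau> / 1" using \<tau> M_ge_2 by (intro divide_left_mono) auto
    also have "\<tau> / 1 = \<tau> * 1" by simp
    also have "\<tau> * 1 \<le> \<tau> * real L ^ N" using \<tau> L by (intro mult_left_mono one_le_power) auto
    finally show ?thesis by (simp add: T_def)
  qed
  \<comment> \<open>\<open>\<tau> / M\<close> is the tolerance of a hit, and \<open>T\<close> pays
    for moving from \<open>x\<close> to the corner \<open>y\<close>: height times side of the cube.
    In the determinant bound one factor \<open>T\<close> turns the factorial into 1 / 2, and
    \<open>2 * T\<close> is at most 1.\<close>
  define \<rho> where "\<rho> = (\<tau> / M + T) / real L ^ k"
  have "fact CARD('n) * (\<tau> * real L ^ (N * Suc k) * \<rho> ^ N) = fact CARD('n) * T * (\<tau> / M + T) ^ N"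
    using L0 by (simp add: \<rho>_def T_def power_divide power_mult[symmetric] power_add mult.commute)
  also have "\<dots> = 1 / 2 * (\<tau> / M + T) ^ N" by (simp add: T)
  also have "\<dots> \<le> 1 / 2 * (2 * T) ^ N"
    using \<open>\<tau> / M \<le> T\<close> \<tau> T0 by (intro mult_left_mono power_mono add_nonneg_nonneg) auto
  also have "\<dots> \<le> 1 / 2 * 1"
    by (intro mult_left_mono power_le_one) (auto simp: T)
  finally have small: "fact CARD('n) * (\<tau> * real L ^ (N * Suc k) * \<rho> ^ (CARD('n) - 1)) < 1"
    by (simp add: N_def)
  have near: "\<bar>real_of_int (q $ h)\<bar> \<le> \<tau> * real L ^ (N * Suc k) \<and>
      (\<forall>i. i \<noteq> h \<longrightarrow> \<bar>of_int (q $ i) - of_int (q $ h) * y $ i\<bar> \<le> \<rho>)" if "q \<in> ?R" for q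
  proof (intro conjI allI impI)
    obtain x where x: "x \<in> cube k z" and q: "hit_by k q x" using \<open>q \<in> ?R\<close> by blast
    show H: "\<bar>real_of_int (q $ h)\<bar> \<le> \<tau> * real L ^ (N * Suc k)"
      using q unfolding hit_by_def by (meson less_imp_le)
    fix i assume "i \<noteq> h"
    have "\<bar>of_int (q $ h) * (x $ i - y $ i)\<bar> \<le> \<tau> * real L ^ (N * Suc k) * (1 / real M ^ k)"
      unfolding abs_mult using H dx[OF x, of i] by (intro mult_mono) auto
    then have 1: "\<bar>of_int (q $ h) * (x $ i - y $ i)\<bar> \<le> T / real L ^ k"
      using MT by simp
    have 2: "\<bar>of_int (q $ i) - of_int (q $ h) * x $ i\<bar> < \<tau> / M / real L ^ k"
      using q \<open>i \<noteq> h\<close> unfolding hit_by_def by blast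
    have "\<bar>of_int (q $ i) - of_int (q $ h) * y $ i\<bar>
        = \<bar>(of_int (q $ i) - of_int (q $ h) * x $ i) + of_int (q $ h) * (x $ i - y $ i)\<bar>"
      by (simp add: algebra_simps)
    also have "\<dots> \<le> \<rho>"
      using 1 2 unfolding \<rho>_def add_divide_distrib by linarith
    finally show "\<bar>of_int (q $ i) - of_int (q $ h) * y $ i\<bar> \<le> \<rho>" .
  qed
  obtain a where "a \<noteq> 0" "\<And>q. q \<in> ?R \<Longrightarrow> a \<bullet> real_vec q = 0"
    using simplex_lemma[OF small, of ?R h y] near by blast
  then show ?thesis using that by blast
qed

text \<open>The normal \<open>a\<close> is steepest in direction \<open>j\<close>, so a row of
  subcubes in that direction meets the slab on a short stretch only. In units of a subcube, each of
  two hit points contributes N for the slab and the other coordinates contribute N; passing to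
  labels adds 1.\<close>

lemma hit_separated:
  assumes z: "(k, z) \<in> nodes"
  obtains j where "j \<noteq> h"
    "\<forall>w\<in>subcells z. \<forall>w'\<in>subcells z. hit k w \<longrightarrow> hit k w' \<longrightarrow> (\<forall>i. i \<noteq> j \<longrightarrow> w $ i = w' $ i)
      \<longrightarrow> \<bar>w $ j - w' $ j\<bar> \<le> 3 * N + 1"
proof -
  obtain a where a0: "a \<noteq> 0"
    and a: "\<And>x q. x \<in> cube k z \<Longrightarrow> hit_by k q x \<Longrightarrow> a \<bullet> real_vec q = 0"
    by (rule hit_hyperplane[OF z]) blast
  let ?H = "UNIV - {h}"
  let ?m = "real M ^ Suc k"
  have m0: "?m > 0" using M_ge_2 by simp
  have cardH: "card ?H = N" by (simp add: N_def card_Diff_singleton)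
  then have "?H \<noteq> {}" using N(1) by (metis card.empty not_one_le_zero)
  have "Max ((\<lambda>i. \<bar>a $ i\<bar>) ` ?H) \<in> (\<lambda>i. \<bar>a $ i\<bar>) ` ?H"
    using \<open>?H \<noteq> {}\<close> by (intro Max_in) auto
  then obtain j where j: "j \<noteq> h" "Max ((\<lambda>i. \<bar>a $ i\<bar>) ` ?H) = \<bar>a $ j\<bar>" by blast
  have aj: "\<bar>a $ i\<bar> \<le> \<bar>a $ j\<bar>" if "i \<noteq> h" for i
    unfolding j(2)[symmetric] using that by (intro Max_ge) auto
  have Sle: "(\<Sum>i\<in>?H. \<bar>a $ i\<bar> * c) \<le> N * \<bar>a $ j\<bar> * c" if "c \<ge> 0" for c
  proof -
    have "(\<Sum>i\<in>?H. \<bar>a $ i\<bar> * c) \<le> (\<Sum>i\<in>?H. \<bar>a $ j\<bar> * c)"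
      using aj that by (intro sum_mono mult_right_mono) auto
    then show ?thesis by (simp add: cardH del: card_Diff_insert)
  qed
  \<comment> \<open>Orthogonality to \<open>real_vec q\<close> expresses
    \<open>q $ h * (a \<bullet> x)\<close> through the approximation errors. Division by the lower
    bound for \<open>\<bar>q $ h\<bar>\<close> produces \<open>M ^ Suc k\<close>, since
    \<open>M ^ k = L ^ (N * k) * L ^ k\<close>.\<close>
  have slab: "\<bar>a \<bullet> x\<bar> \<le> N * \<bar>a $ j\<bar> * (1 / ?m)"
    if "x \<in> cube k z" "hit_by k q x" for x q
  proof -
    let ?qh = "real_of_int (q $ h)"
    have xh: "x $ h = 1" using that(1) by (simp add: mem_cube)
    have "a \<bullet> (?qh *\<^sub>R x - real_vec q) = ?qh * (a \<bullet> x)"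
      using a[OF that] by (simp add: inner_diff_right)
    also have "a \<bullet> (?qh *\<^sub>R x - real_vec q)
        = (\<Sum>i\<in>UNIV. a $ i * (?qh * x $ i - of_int (q $ i)))"
      by (simp add: inner_vec_def real_vec_def)
    also have "\<dots> = (\<Sum>i\<in>?H. a $ i * (?qh * x $ i - of_int (q $ i)))"
      using xh by (subst sum.remove[of _ h]) auto
    finally have "\<bar>?qh\<bar> * \<bar>a \<bullet> x\<bar> = \<bar>\<Sum>i\<in>?H. a $ i * (?qh * x $ i - of_int (q $ i))\<bar>"
      by (simp only: abs_mult)
    also have "\<dots> \<le> (\<Sum>i\<in>?H. \<bar>a $ i\<bar> * \<bar>?qh * x $ i - of_int (q $ i)\<bar>)"
      by (rule order_trans[OF sum_abs]) (simp add: abs_mult)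
    also have "\<dots> \<le> (\<Sum>i\<in>?H. \<bar>a $ i\<bar> * (\<tau> / M / real L ^ k))"
      using that(2) unfolding hit_by_def
      by (intro sum_mono mult_left_mono) (auto simp: abs_minus_commute less_imp_le)
    also have "\<dots> \<le> N * \<bar>a $ j\<bar> * (\<tau> / M / real L ^ k)"
      using \<tau> by (intro Sle) auto
    finally have "\<bar>?qh\<bar> * \<bar>a \<bullet> x\<bar> \<le> N * \<bar>a $ j\<bar> * (\<tau> / M / real L ^ k)" .
    moreover have "\<tau> * real L ^ (N * k) * \<bar>a \<bullet> x\<bar> \<le> \<bar>?qh\<bar> * \<bar>a \<bullet> x\<bar>"
      by (intro mult_right_mono hit_height[OF z that]) auto
    ultimately have "\<tau> * real L ^ (N * k) * \<bar>a \<bullet> x\<bar> \<le> N * \<bar>a $ j\<bar> * (\<tau> / M / real L ^ k)"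
      by linarith
    also have "\<tau> / M / real L ^ k = \<tau> * real L ^ (N * k) * (1 / ?m)"
      using L by (simp add: M_eq power_mult_distrib power_mult)
    finally have "\<tau> * real L ^ (N * k) * \<bar>a \<bullet> x\<bar> \<le> \<tau> * real L ^ (N * k) * (N * \<bar>a $ j\<bar> * (1 / ?m))"
      by (simp only: mult_ac)
    then show ?thesis using \<tau> L by (subst (asm) mult_le_cancel_left_pos) auto
  qed
  have "\<bar>w $ j - w' $ j\<bar> \<le> 3 * N + 1"
    if w: "w \<in> subcells z" "w' \<in> subcells z" "hit k w" "hit k w'"
      and eq: "\<And>i. i \<noteq> j \<Longrightarrow> w $ i = w' $ i" for w w'
  proof -
    obtain x q where x: "x \<in> cube (Suc k) w" "hit_by k q x"
      using w(3) by (auto simp: hit_def)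
    obtain y r where y: "y \<in> cube (Suc k) w'" "hit_by k r y"
      using w(4) by (auto simp: hit_def)
    have ax: "\<bar>a \<bullet> x\<bar> \<le> N * \<bar>a $ j\<bar> * (1 / ?m)"
      using slab cube_subset[OF w(1)] x by blast
    have ay: "\<bar>a \<bullet> y\<bar> \<le> N * \<bar>a $ j\<bar> * (1 / ?m)"
      using slab cube_subset[OF w(2)] y by blast
    have h1: "x $ h = 1" "y $ h = 1" using x(1) y(1) by (auto simp: mem_cube)
    \<comment> \<open>If \<open>a\<close> vanished outside \<open>h\<close>, then
      \<open>a \<bullet> x\<close> would be \<open>a $ h\<close>, and the slab bound would make this
      0 as well.\<close>
    have aj0: "\<bar>a $ j\<bar> > 0"
    proof (rule ccontr)
      assume "\<not> ?thesis"
      then have zero: "a $ i = 0" if "i \<noteq> h" for i using aj[OF that] by simp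
      have "a \<bullet> x = (\<Sum>i\<in>UNIV. if i = h then a $ h else 0)"
        unfolding inner_vec_def using zero h1 by (intro sum.cong) auto
      also have "\<dots> = a $ h" by simp
      finally have "a $ h = 0" using ax zero[OF j(1)] by simp
      then have "a = 0" using zero by (metis vec_eq_iff zero_index)
      with a0 show False ..
    qed
    have near: "\<bar>x $ i - y $ i\<bar> \<le> 1 / ?m" if "i \<noteq> h" "i \<noteq> j" for i
    proof -
      have "\<bar>M ^ Suc k * x $ i - M ^ Suc k * y $ i\<bar> \<le> 1"
        using x(1) y(1) that eq[of i] unfolding mem_cube by (smt (verit))
      then have "?m * \<bar>x $ i - y $ i\<bar> \<le> 1"
        by (simp only: right_diff_distrib[symmetric] abs_mult of_nat_power) simp
      then show ?thesis using m0 by (simp add: field_simps)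
    qed
    have "a \<bullet> x - a \<bullet> y = (\<Sum>i\<in>UNIV. a $ i * (x $ i - y $ i))"
      by (simp add: inner_vec_def sum_subtractf[symmetric] right_diff_distrib)
    also have "\<dots> = (\<Sum>i\<in>?H. a $ i * (x $ i - y $ i))"
      using h1 by (subst sum.remove[of _ h]) auto
    also have "\<dots> = a $ j * (x $ j - y $ j) + (\<Sum>i\<in>?H - {j}. a $ i * (x $ i - y $ i))"
      using j(1) by (intro sum.remove) auto
    finally have "a $ j * (x $ j - y $ j) = a \<bullet> x - a \<bullet> y - (\<Sum>i\<in>?H - {j}. a $ i * (x $ i - y $ i))"
      by simp
    then have "\<bar>a $ j\<bar> * \<bar>x $ j - y $ j\<bar>
        \<le> \<bar>a \<bullet> x\<bar> + \<bar>a \<bullet> y\<bar> + \<bar>\<Sum>i\<in>?H - {j}. a $ i * (x $ i - y $ i)\<bar>"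
      unfolding abs_mult[symmetric] by linarith
    also have "\<bar>\<Sum>i\<in>?H - {j}. a $ i * (x $ i - y $ i)\<bar> \<le> (\<Sum>i\<in>?H - {j}. \<bar>a $ i\<bar> * (1 / ?m))"
    proof (rule order_trans[OF sum_abs], rule sum_mono)
      fix i assume "i \<in> ?H - {j}"
      then show "\<bar>a $ i * (x $ i - y $ i)\<bar> \<le> \<bar>a $ i\<bar> * (1 / ?m)"
        unfolding abs_mult by (intro mult_left_mono near) auto
    qed
    also have "\<dots> \<le> (\<Sum>i\<in>?H. \<bar>a $ i\<bar> * (1 / ?m))"
      using m0 by (intro sum_mono2) auto
    also have "\<dots> \<le> N * \<bar>a $ j\<bar> * (1 / ?m)"
      using m0 by (intro Sle) auto
    finally have "\<bar>a $ j\<bar> * \<bar>x $ j - y $ j\<bar> \<le> 3 * (N * \<bar>a $ j\<bar> * (1 / ?m))"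
      using ax ay by linarith
    also have "\<dots> = \<bar>a $ j\<bar> * (3 * N / ?m)" by simp
    finally have "\<bar>a $ j\<bar> * \<bar>x $ j - y $ j\<bar> \<le> \<bar>a $ j\<bar> * (3 * N / ?m)" .
    then have "\<bar>x $ j - y $ j\<bar> \<le> 3 * N / ?m"
      using aj0 by (simp only: mult_le_cancel_left_pos)
    then have "?m * \<bar>x $ j - y $ j\<bar> \<le> 3 * N"
      using m0 by (simp add: field_simps)
    then have "\<bar>M ^ Suc k * x $ j - M ^ Suc k * y $ j\<bar> \<le> 3 * N"
      using m0 by (simp only: right_diff_distrib[symmetric] abs_mult of_nat_power)
    moreover have "of_int (w $ j) \<le> M ^ Suc k * x $ j \<and> M ^ Suc k * x $ j \<le> of_int (w $ j) + 1"
      "of_int (w' $ j) \<le> M ^ Suc k * y $ j \<and> M ^ Suc k * y $ j \<le> of_int (w' $ j) + 1"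
      using x(1) y(1) j(1) unfolding mem_cube by blast+
    ultimately have "\<bar>real_of_int (w $ j) - real_of_int (w' $ j)\<bar> \<le> 3 * real N + 1"
      unfolding of_nat_mult of_nat_numeral by linarith
    then show ?thesis by linarith
  qed
  then show ?thesis using that[OF j(1)] by blast
qed

section \<open>Counting the surviving subcubes\<close>

lemma subcells_finite: "finite (subcells z)"
  unfolding subcells_def by (rule finite_vec_box) auto

lemma card_subcells: "card (subcells z) = M ^ N"
proof -
  have "card (subcells z) = (\<Prod>i\<in>UNIV. card (if i = h then {0} else {M * z $ i..<M * z $ i + M}))"
    unfolding subcells_def by (rule card_vec_box)
  also have "\<dots> = (\<Prod>i\<in>UNIV. if i = h then 1 else M)"
    by (intro prod.cong) auto
  finally show ?thesis by (simp add: prod_except N_def)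
qed

text \<open>Reduction of coordinate \<open>j\<close> modulo 3 * N + 2 is injective on hit subcubes,
  because those that agree elsewhere differ there by less than the modulus. So 3 * N + 2 values
  replace \<open>M\<close> in one coordinate.\<close>

lemma card_hit_le:
  assumes "(k, z) \<in> nodes"
  shows "card {w \<in> subcells z. hit k w} \<le> (3 * N + 2) * M ^ (N - 1)"
proof -
  let ?D = "int (3 * N + 2)"
  obtain j where j: "j \<noteq> h"
    "\<forall>w\<in>subcells z. \<forall>w'\<in>subcells z. hit k w \<longrightarrow> hit k w' \<longrightarrow> (\<forall>i. i \<noteq> j \<longrightarrow> w $ i = w' $ i)
      \<longrightarrow> \<bar>w $ j - w' $ j\<bar> \<le> 3 * N + 1"
    using hit_separated[OF assms] .
  define S where "S i = (if i = j then {0..<?D} else if i = h then {0} else {M * z $ i..<M * z $ i + M})" for i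
  define g :: "int ^ 'n \<Rightarrow> int ^ 'n" where "g w = (\<chi> i. if i = j then w $ j mod ?D else w $ i)" for w
  have "inj_on g {w \<in> subcells z. hit k w}"
  proof (rule inj_onI)
    fix w w' assume w: "w \<in> {w \<in> subcells z. hit k w}" "w' \<in> {w \<in> subcells z. hit k w}"
      and eq: "g w = g w'"
    have same: "w $ i = w' $ i" if "i \<noteq> j" for i
      using arg_cong[OF eq, of "\<lambda>v. v $ i"] that by (simp add: g_def)
    have "w $ j mod ?D = w' $ j mod ?D"
      using arg_cong[OF eq, of "\<lambda>v. v $ j"] by (simp add: g_def)
    then have "?D dvd w $ j - w' $ j" by (simp add: mod_eq_dvd_iff)
    moreover have "\<bar>w $ j - w' $ j\<bar> < ?D"
      using j(2) w same by fastforce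
    ultimately have "w $ j = w' $ j"
      using zdvd_imp_le[of ?D "\<bar>w $ j - w' $ j\<bar>"] by force
    then show "w = w'" using same by (metis vec_eq_iff)
  qed
  moreover have "g ` {w \<in> subcells z. hit k w} \<subseteq> {w. \<forall>i. w $ i \<in> S i}"
    by (auto simp: g_def S_def subcells_def)
  moreover have "finite {w :: int ^ 'n. \<forall>i. w $ i \<in> S i}"
    by (rule finite_vec_box) (auto simp: S_def)
  ultimately have "card {w \<in> subcells z. hit k w} \<le> card {w :: int ^ 'n. \<forall>i. w $ i \<in> S i}"
    by (rule card_inj_on_le)
  also have "\<dots> = (\<Prod>i\<in>UNIV. card (S i))" by (rule card_vec_box)
  also have "\<dots> = card (S j) * (\<Prod>i\<in>UNIV - {j}. card (S i))"
    by (intro prod.remove) auto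
  also have "(\<Prod>i\<in>UNIV - {j}. card (S i)) = (\<Prod>i\<in>UNIV - {j}. if i = h then 1 else M)"
    by (intro prod.cong) (auto simp: S_def)
  also have "\<dots> = M ^ (N - 1)"
    using j(1) by (subst prod_except) (auto simp: N_def card_Diff_singleton)
  also have "card (S j) = 3 * N + 2"
    unfolding S_def by (simp only: simp_thms if_True card_atLeastLessThan_int diff_zero nat_int)
  finally show ?thesis .
qed

lemma children_nodes: "v \<in> nodes \<Longrightarrow> children v \<subseteq> nodes"
  using subcells_nodes by (cases v) (auto simp: children_def)

lemma finite_children: "finite (children v)"
  unfolding children_def using subcells_finite by auto

lemma card_children_ge:
  assumes "v \<in> nodes"
  shows "real (card (children v)) \<ge> real M ^ N - (3 * N + 2) * real M ^ (N - 1)"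
proof -
  obtain k z where v: "v = (k, z)" by (cases v)
  let ?H = "{w \<in> subcells z. hit k w}"
  have "children v = Pair (Suc k) ` (subcells z - ?H)"
    by (auto simp: v children_def)
  then have "card (children v) = card (subcells z - ?H)"
    by (simp add: card_image inj_on_def)
  also have "\<dots> = card (subcells z) - card ?H"
    using subcells_finite by (intro card_Diff_subset) auto
  finally have "real (card (children v)) \<ge> real (card (subcells z)) - real (card ?H)"
    by simp
  moreover have "real (card ?H) \<le> real ((3 * N + 2) * M ^ (N - 1))"
    using card_hit_le assms unfolding v of_nat_le_iff .
  ultimately show ?thesis unfolding card_subcells by (simp add: algebra_simps)
qed

lemma descendants_nodes:
  assumes "(j, w) \<in> descendants children k v" "v \<in> nodes"
  shows "j = fst v + k \<and> (j, w) \<in> nodes"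
  using assms
proof (induction k arbitrary: v)
  case (Suc k)
  then obtain u where u: "u \<in> children v" "(j, w) \<in> descendants children k u" by auto
  then have "fst u = Suc (fst v)" "u \<in> nodes"
    using children_nodes[OF Suc.prems(2)] by (auto simp: children_def)
  then show ?case using Suc.IH[OF u(2)] by auto
qed auto

abbreviation root :: "nat \<times> (int ^ 'n)" where "root \<equiv> (0, 0)"

lemma root_nodes: "root \<in> nodes"
  by (simp add: nodes_def)

section \<open>Cells met by a small set\<close>

text \<open>Reverses \<open>dist_proj_of_le\<close> up to a factor, as norms are at most
  \<open>CARD('n)\<close> on the unit cube. The factor dictates the scale
  \<open>1 / CARD('n) ^ 2\<close> in the tree argument.\<close>

lemma cube_coordinate_diff_le:
  assumes "(k, z) \<in> nodes" "(k, z') \<in> nodes" "x \<in> cube k z" "y \<in> cube k z'"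
  shows "\<bar>x $ i - y $ i\<bar> \<le> real CARD('n) ^ 2 * dist (proj_of x) (proj_of y)"
proof -
  have h1: "x $ h = 1" "y $ h = 1" using assms by (auto simp: mem_cube)
  then have 0: "x \<noteq> 0" "y \<noteq> 0" by auto
  have "norm x \<le> real CARD('n) * 1"
    by (rule norm_le_card) (use cube_unit[OF assms(1,3)] in simp)
  moreover have "norm y \<le> real CARD('n) * 1"
    by (rule norm_le_card) (use cube_unit[OF assms(2,4)] in simp)
  ultimately have "norm x * norm y \<le> real CARD('n) * real CARD('n)"
    by (intro mult_mono) auto
  then have le: "norm x * norm y \<le> real CARD('n) ^ 2" by (simp add: power2_eq_square)
  have "\<bar>x $ i - y $ i\<bar> \<le> wedge_norm x y"
    using wedge_entry_le[of x i y h] h1 by simp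
  also have "\<dots> = norm x * norm y * dist (proj_of x) (proj_of y)"
    using 0 by (simp add: dist_proj_of)
  also have "\<dots> \<le> real CARD('n) ^ 2 * dist (proj_of x) (proj_of y)"
    using le by (intro mult_right_mono) auto
  finally show ?thesis .
qed

text \<open>Points over \<open>U\<close> differ by at most one side in each coordinate and lie
  anywhere in their closed cubes, so labels differ by at most 2: five values each.\<close>

lemma card_cells_meeting:
  fixes U :: "'n proj set"
  assumes U: "bounded U" "diameter U \<le> 1 / real CARD('n) ^ 2 / real M ^ k"
  shows "card {v \<in> descendants children k root. proj_of ` cube (fst v) (snd v) \<inter> U \<noteq> {}}
    \<le> 5 ^ CARD('n)" (is "card ?D \<le> _")
proof (cases "?D = {}")
  case True
  show ?thesis unfolding True by simp
next
  case False
  have M0: "real M ^ k > 0" using M_ge_2 by simp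
  have D: "\<exists>z x. v = (k, z) \<and> (k, z) \<in> nodes \<and> x \<in> cube k z \<and> proj_of x \<in> U" if "v \<in> ?D" for v
    using that descendants_nodes[of "fst v" "snd v" k root] root_nodes by (cases v) auto
  then obtain z x where z: "(k, z) \<in> nodes" "x \<in> cube k z" "proj_of x \<in> U"
    using False by blast
  let ?B = "{w :: int ^ 'n. \<forall>i. w $ i \<in> {z $ i - 2..z $ i + 2}}"
  have "?D \<subseteq> Pair k ` ?B"
  proof
    fix v assume "v \<in> ?D"
    then obtain w y where v: "v = (k, w)" "(k, w) \<in> nodes" "y \<in> cube k w" "proj_of y \<in> U"
      using D by blast
    have "dist (proj_of x) (proj_of y) \<le> 1 / real CARD('n) ^ 2 / real M ^ k"
      using diameter_bounded_bound[OF U(1) z(3) v(4)] U(2) by simp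
    then have "real CARD('n) ^ 2 * dist (proj_of x) (proj_of y) \<le> 1 / real M ^ k"
      using M0 by (simp add: field_simps)
    then have near: "\<bar>x $ i - y $ i\<bar> \<le> 1 / real M ^ k" for i
      using cube_coordinate_diff_le[OF z(1) v(2) z(2) v(3), of i] by simp
    have "w $ i \<in> {z $ i - 2..z $ i + 2}" for i
    proof (cases "i = h")
      case True
      then show ?thesis using z(1) v(2) by (simp add: nodes_def)
    next
      case False
      have "M ^ k * \<bar>x $ i - y $ i\<bar> \<le> 1"
        using near[of i] M0 by (simp add: field_simps)
      then have "\<bar>M ^ k * x $ i - M ^ k * y $ i\<bar> \<le> 1"
        by (simp add: right_diff_distrib[symmetric] abs_mult)
      moreover have "of_int (z $ i) \<le> M ^ k * x $ i \<and> M ^ k * x $ i \<le> of_int (z $ i) + 1"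
        "of_int (w $ i) \<le> M ^ k * y $ i \<and> M ^ k * y $ i \<le> of_int (w $ i) + 1"
        using z(2) v(3) False unfolding mem_cube by blast+
      ultimately have "\<bar>real_of_int (z $ i) - real_of_int (w $ i)\<bar> \<le> 2"
        by linarith
      then have "\<bar>z $ i - w $ i\<bar> \<le> 2" by linarith
      then show ?thesis by auto
    qed
    then show "v \<in> Pair k ` ?B" by (auto simp: v(1))
  qed
  moreover have "finite ?B" by (rule finite_vec_box) auto
  ultimately have "card ?D \<le> card (Pair k ` ?B)" by (intro card_mono) auto
  also have "\<dots> \<le> card ?B" using \<open>finite ?B\<close> by (rule card_image_le)
  also have "\<dots> = 5 ^ CARD('n)" unfolding card_vec_box by simp
  finally show ?thesis .
qed

section \<open>Limits of branches\<close>

lemma bad_proj_of: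
  assumes x: "\<And>i. 0 \<le> x $ i" "\<And>i. x $ i \<le> 1" "x $ h = 1"
    and not_hit: "\<And>k q. \<not> hit_by k q x"
  shows "proj_of x \<in> bad_proj"
proof -
  \<comment> \<open>For a rational point of height H in window \<open>k\<close>, the absence of a
    hit bounds the distance below by \<open>\<tau> / M / L ^ k / (CARD('n) ^ 2 * H)\<close>, and
    \<open>H powr (1 / N)\<close> is at least \<open>\<tau> powr (1 / N) * L ^ k\<close>. In the
    product \<open>L ^ k\<close> and H cancel.\<close>
  define c where "c = \<tau> powr (1 / N) * (\<tau> / M) / real CARD('n) ^ 2"
  have L0: "real L > 0" and M0: "real M > 0" using L M_ge_2 by auto
  have c: "c > 0" using \<tau> M0 by (simp add: c_def)
  have x0: "x \<noteq> 0" using x(3) by auto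
  have nx: "norm x \<le> real CARD('n) * 1" by (rule norm_le_card) (use x in simp)
  have "c \<le> height p powr (real CARD('n) / (real CARD('n) - 1)) * dist (proj_of x) p"
    if p: "p \<in> rat_points" for p
  proof -
    obtain q where q: "primitive_rep q p" using primitive_rep_exists[OF p] .
    define H where "H = Max (range (\<lambda>i. \<bar>q $ i\<bar>))"
    have height: "height p = H" using height_eq[OF q] by (simp add: H_def)
    have qH: "\<bar>q $ i\<bar> \<le> H" for i unfolding H_def by (intro Max_ge) auto
    have "H \<in> range (\<lambda>i. \<bar>q $ i\<bar>)" unfolding H_def by (intro Max_in) auto
    then obtain i0 where i0: "H = \<bar>q $ i0\<bar>" by blast
    have rq: "real_vec q \<noteq> 0" and p_eq: "p = proj_of (real_vec q)"
      using q primitive_nonzero[of q] by (auto simp: primitive_rep_def)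
    have "H \<noteq> 0"
    proof
      assume "H = 0"
      then have "q $ i = 0" for i using qH[of i] by simp
      then show False using rq by (simp add: real_vec_def vec_eq_iff)
    qed
    then have H1: "H \<ge> 1" using i0 by simp
    have "real L ^ N > 1" using L N by (intro one_less_power) auto
    then obtain n where "H / \<tau> < (real L ^ N) ^ n" using real_arch_pow by blast
    then have "H < \<tau> * real L ^ (N * n)" using \<tau> unfolding power_mult
      by (simp add: pos_divide_less_eq mult.commute)
    \<comment> \<open>By \<open>\<tau> \<le> 1\<close>, window 0 starts no later than the least
      height 1.\<close>
    moreover have "\<not> H < \<tau> * real L ^ (N * 0)" using H1 \<tau> by simp
    ultimately obtain k where k: "\<not> H < \<tau> * real L ^ (N * k)" "H < \<tau> * real L ^ (N * Suc k)"
      by (metis dec_induct[of 0 n "\<lambda>k. \<not> real_of_int H < \<tau> * real L ^ (N * k)"] le0)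
    have "\<bar>of_int (q $ i)\<bar> < \<tau> * real L ^ (N * Suc k)" for i
      using qH[of i] k(2) by linarith
    moreover have "\<tau> * real L ^ (N * k) \<le> \<bar>of_int (q $ i0)\<bar>"
      using k(1) i0 by linarith
    ultimately obtain i where i: "i \<noteq> h"
      "\<tau> / M / real L ^ k \<le> \<bar>of_int (q $ i) - of_int (q $ h) * x $ i\<bar>"
      using not_hit[of k q] unfolding hit_by_def by (meson not_less)
    have "\<bar>of_int (q $ i) - of_int (q $ h) * x $ i\<bar> \<le> wedge_norm x (real_vec q)"
      using wedge_entry_le[of x h "real_vec q" i] x(3) by (simp add: real_vec_def mult.commute)
    with i have w: "\<tau> / M / real L ^ k \<le> wedge_norm x (real_vec q)" by linarith
    have nq: "norm (real_vec q) \<le> CARD('n) * real_of_int H"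
      by (rule norm_le_card) (use qH in \<open>simp add: real_vec_def flip: of_int_abs\<close>)
    have "norm x * norm (real_vec q) \<le> CARD('n) * (CARD('n) * real_of_int H)"
      using nx nq by (intro mult_mono) auto
    then have nn: "norm x * norm (real_vec q) \<le> CARD('n) ^ 2 * real_of_int H"
      by (simp add: power2_eq_square)
    have "\<tau> / M / real L ^ k / (CARD('n) ^ 2 * H) \<le> wedge_norm x (real_vec q) / (norm x * norm (real_vec q))"
      using w nn x0 rq wedge_norm_nonneg by (intro frac_le) auto
    then have d: "\<tau> / M / real L ^ k / (CARD('n) ^ 2 * H) \<le> dist (proj_of x) p"
      unfolding p_eq dist_proj_of[OF x0 rq] .
    have "real N > 0" using N by simp
    have "\<tau> powr (1 / N) * real L ^ k = (\<tau> * real L ^ (N * k)) powr (1 / N)"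
      using \<tau> L0 \<open>real N > 0\<close>
      by (simp add: powr_mult powr_realpow[symmetric] powr_powr)
    also have "\<dots> \<le> H powr (1 / N)"
      using k(1) \<tau> by (intro powr_mono2) auto
    finally have HN: "\<tau> powr (1 / N) * real L ^ k \<le> H powr (1 / N)" .
    have "c = (\<tau> powr (1 / N) * real L ^ k * H) * (\<tau> / M / real L ^ k / (CARD('n) ^ 2 * H))"
      using L0 H1 by (simp add: c_def)
    also have "\<dots> \<le> (H powr (1 / N) * H) * dist (proj_of x) p"
      using HN d H1 \<tau> by (intro mult_mono mult_right_mono) auto
    also have "H powr (1 / N) * H = H powr (1 / N + 1)"
      using H1 by (simp add: powr_add)
    also have "1 / N + 1 = real CARD('n) / (real CARD('n) - 1)"
      using \<open>real N > 0\<close> by (simp add: N(2) field_simps)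
    finally show ?thesis by (simp add: height)
  qed
  moreover have "(rat_points :: 'n proj set) \<noteq> {}"
    by (auto simp: rat_points_def intro!: exI[of _ "proj_of 1"] exI[of _ "1 :: real ^ 'n"])
  ultimately have "c \<le> (INF p\<in>rat_points.
      height p powr (real CARD('n) / (real CARD('n) - 1)) * dist (proj_of x) p)"
    by (intro cINF_greatest)
  with c show ?thesis by (simp add: bad_proj_def)
qed

text \<open>Nested nonempty compact cubes share a point. For every \<open>k\<close> it lies in a
  cube that survived window \<open>k\<close>, so it is never hit.\<close>

lemma branch_limit:
  assumes b: "b 0 = root" "\<And>n. b (Suc n) \<in> children (b n)"
  shows "\<exists>p\<in>bad_proj. \<forall>n. p \<in> proj_of ` cube (fst (b n)) (snd (b n))"
proof -
  define z where "z n = snd (b n)" for n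
  have "fst (b n) = n" for n
  proof (induction n)
    case (Suc n)
    then show ?case using b(2)[of n] by (auto simp: children_def)
  qed (simp add: b(1))
  then have bn: "b n = (n, z n)" for n by (metis prod.collapse z_def)
  have z: "z (Suc n) \<in> subcells (z n)" "\<not> hit n (z (Suc n))" for n
    using b(2)[of n] by (auto simp: bn children_def)
  have "M ^ n > 0" for n using M_ge_2 by simp
  then have "cube n w \<noteq> {}" for n w
    using mem_cube[of "\<chi> i. if i = h then 1 else of_int (w $ i) / real M ^ n" n w] by fastforce
  moreover have "cube (Suc n) (z (Suc n)) \<subseteq> cube n (z n)" for n
    by (rule cube_subset[OF z(1)])
  then have "cube n (z n) \<subseteq> cube m (z m)" if "m \<le> n" for m n
    using that by (rule lift_Suc_antimono_le)
  ultimately have "(\<Inter>n. cube n (z n)) \<noteq> {}"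
    by (intro compact_nest) (auto simp: cube_def)
  then obtain x where x: "\<And>n. x \<in> cube n (z n)" by auto
  have root: "(0, z 0) \<in> nodes" using root_nodes b(1) bn[of 0] by simp
  have "proj_of x \<in> bad_proj"
  proof (rule bad_proj_of)
    show "0 \<le> x $ i" "x $ i \<le> 1" for i using cube_unit[OF root x] by auto
    show "x $ h = 1" using x[of 0] by (simp add: mem_cube)
    show "\<not> hit_by k q x" for k q using z(2)[of k] x[of "Suc k"] by (auto simp: hit_def)
  qed
  then show ?thesis using x by (auto simp: bn)
qed

lemma hausdorff_measure_bad_nonzero:
  assumes s: "s \<ge> 0" and m: "M powr s \<le> real M ^ N - (3 * N + 2) * real M ^ (N - 1)"
    "1 < real M ^ N - (3 * N + 2) * real M ^ (N - 1)"
  shows "hausdorff_measure s (bad_proj :: 'n proj set) \<noteq> 0"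
proof (rule hausdorff_measure_tree_nonzero)
  show "parent w = v" if "v \<in> nodes" "w \<in> children v" for v w
    using that by (rule parent_children)
  show "finite (children v) \<and> children v \<subseteq> nodes \<and>
      real M ^ N - (3 * N + 2) * real M ^ (N - 1) \<le> card (children v)" if "v \<in> nodes" for v
    using finite_children children_nodes[OF that] card_children_ge[OF that] by blast
  show "root \<in> nodes" by (rule root_nodes)
  show "real M > 1" using M_ge_2 by simp
  show "1 / real CARD('n) ^ 2 > 0" by simp
  show "\<exists>p\<in>bad_proj. \<forall>n. p \<in> proj_of ` cube (fst (b n)) (snd (b n))"
    if "b 0 = root" "\<And>n. b (Suc n) \<in> children (b n)" for b
    using that by (rule branch_limit)
qed (use s m card_cells_meeting in auto)

end

section \<open>The dimension of the set of badly approximable points\<close>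

lemma hausdorff_dim_bad_proj_ge:
  assumes "CARD('n::finite) \<ge> 2"
  shows "ereal (real (CARD('n) - 1)) \<le> hausdorff_dim (bad_proj :: 'n proj set)"
  unfolding hausdorff_dim_def
proof (rule INF_greatest)
  let ?N = "CARD('n) - 1"
  fix s assume "s \<in> {s. s \<ge> 0 \<and> hausdorff_measure s (bad_proj :: 'n proj set) = 0}"
  then have s: "s \<ge> 0" and zero: "hausdorff_measure s (bad_proj :: 'n proj set) = 0" by auto
  show "ereal (real ?N) \<le> ereal s"
  proof (rule ccontr)
    assume "\<not> ?thesis"
    then have less: "s < real ?N" by simp
    define D where "D = real (3 * ?N + 2)"
    \<comment> \<open>\<open>M \<ge> r\<close> gives \<open>M powr (N - s) \<ge> 2\<close>, and
      \<open>M \<ge> 2 * D\<close> ensures that at least half of the subcubes survive; hence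
      \<open>M powr s \<le> M ^ N / 2\<close> suffices.\<close>
    define r where "r = 2 powr (1 / (real ?N - s))"
    obtain L :: nat where large: "max (2 * D) r \<le> L" using real_arch_simple by blast
    \<comment> \<open>Any coordinate may define the chart.\<close>
    obtain h :: 'n where True by blast
    have "D \<ge> 2" by (simp add: D_def)
    have "real L \<ge> 2" using large \<open>D \<ge> 2\<close> by simp
    then have "L \<ge> 2" by linarith
    interpret cube_tree h L
      by standard (use assms \<open>L \<ge> 2\<close> in auto)
    have MD: "real M \<ge> 2 * D" and Mr: "real M \<ge> r"
      using large of_nat_mono[OF M_ge_L, where 'a = real] by auto
    have M1: "real M \<ge> 1" using M_ge_2 by simp
    have D: "D = real (3 * N + 2)" by (simp add: D_def N_def)
    obtain n where n: "N = Suc n" using N(1) by (cases N) auto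
    have "real M ^ N - D * real M ^ (N - 1) = (real M - D) * real M ^ n"
      by (simp add: n left_diff_distrib)
    also have "\<dots> \<ge> real M / 2 * real M ^ n"
      using MD M1 by (intro mult_right_mono) auto
    finally have half: "real M ^ N / 2 \<le> real M ^ N - D * real M ^ (N - 1)"
      by (simp add: n)
    have "2 = r powr (real N - s)"
      using less by (simp add: r_def powr_powr N_def)
    also have "\<dots> \<le> real M powr (real N - s)"
      using Mr less by (intro powr_mono2) (auto simp: r_def N_def)
    also have "\<dots> = real M ^ N / real M powr s"
      using M1 by (simp add: powr_diff powr_realpow)
    finally have "real M powr s \<le> real M ^ N / 2"
      using M1 by (simp add: field_simps)
    moreover have "1 < real M ^ N / 2"
    proof -
      have "real M * 1 \<le> real M * real M ^ n"
        using M1 by (intro mult_left_mono one_le_power) auto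
      then have "real M * real M ^ n > 2" using MD \<open>D \<ge> 2\<close> by linarith
      then show ?thesis by (simp add: n)
    qed
    ultimately have "hausdorff_measure s (bad_proj :: 'n proj set) \<noteq> 0"
      using half s unfolding D by (intro hausdorff_measure_bad_nonzero) auto
    with zero show False by contradiction
  qed
qed

theorem theorem9:
  fixes N :: nat
  assumes "N \<ge> 1" and "CARD('n::finite) = N + 1"
  shows "hausdorff_dim (bad_proj :: 'n proj set) = ereal (real N)"
  using hausdorff_dim_bad_proj_ge[where 'n = 'n] hausdorff_dim_proj_le[of "bad_proj :: 'n proj set"] assms
  by (intro antisym) auto

end
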